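(* Let $p$ be a prime, let $n,d$ be positive integers, let $\delta\in(0,1]$ be a distance parameter, and let $t$ be an erasure parameter with $t \leq \frac{\delta}{30}p^{n/(20d)}$. Then there is a $t$-online-erasure-resilient tester for degree $d$ for functions $f:\mathbb{F}_p^n\to\mathbb{F}_p$ with query complexity $O\!\left(\frac{\log^{3d+3}(t/\delta)}{\delta}\right)$, satisfying: (Completeness) if $f$ has degree at most $d$, the tester accepts with probability $1$; (Soundness) if $f$ is $\delta$-far from degree $d$, the tester rejects with probability at least $2/3$.
   Context: Every function $f:\mathbb{F}_q^n\to\mathbb{F}_q$ has a unique polynomial representation $f(x)=\sum_{e\in\{0,\dots,q-1\}^n} C_e x^e$ with $x^e=\prod_i x_i^{e_i}$; its degree is $\max\{|e|_1 : C_e\neq 0\}$ where $|e|_1=\sum_i e_i$. For $f,g$ on $\mathbb{F}_q^n$, $\delta(f,g)=\Pr_{x\in\mathbb{F}_q^n}[f(x)\neq g(x)]$ (uniform $x$), and $f$ is $\delta$-far from degree $d$ if $\min_{g:\deg g\le d}\delta(f,g)\geq \delta$. The $t$-online-erasure model: a (randomized, adaptive) tester receives parameters $n,d,\delta,t$ and query access to $f$. Initially no entry of the truth table of $f$ is erased. The tester queries points $x$ one at a time; after each query, an adversary (who may know all queries so far) may erase any $t$ entries of the truth table of $f$. A query to an erased point returns the symbol $\perp$; otherwise it returns $f(x)$. A tester is $t$-online-erasure-resilient if its completeness and soundness guarantees hold against every such adversary. The query complexity is the number of queries made. *)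

theory Defs
  imports "HOL-Probability.Probability" "HOL-Computational_Algebra.Primes"
begin

definition Fpn :: "nat \<Rightarrow> nat \<Rightarrow> nat list set" where
  "Fpn p n = {x. length x = n \<and> (\<forall>i\<in>set x. i < p)}"

(* f is a function F_p^n -> F_p (values outside the domain are irrelevant) *)
definition is_fn :: "nat \<Rightarrow> nat \<Rightarrow> (nat list \<Rightarrow> nat) \<Rightarrow> bool" where
  "is_fn p n f \<longleftrightarrow> (\<forall>x\<in>Fpn p n. f x < p)"

definition mono_eval :: "nat list \<Rightarrow> nat list \<Rightarrow> nat" where
  "mono_eval x e = (\<Prod>i<length x. (x ! i) ^ (e ! i))"

(* degree of the unique representation with exponents in {0..p-1}^n is at most d *)
definition deg_le :: "nat \<Rightarrow> nat \<Rightarrow> nat \<Rightarrow> (nat list \<Rightarrow> nat) \<Rightarrow> bool" where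
  "deg_le p n d f \<longleftrightarrow> (\<exists>C :: nat list \<Rightarrow> nat. \<forall>x\<in>Fpn p n.
      f x = (\<Sum>e\<in>Fpn p n. if sum_list e \<le> d then C e * mono_eval x e else 0) mod p)"

definition rel_dist :: "nat \<Rightarrow> nat \<Rightarrow> (nat list \<Rightarrow> nat) \<Rightarrow> (nat list \<Rightarrow> nat) \<Rightarrow> real" where
  "rel_dist p n f g = real (card {x\<in>Fpn p n. f x \<noteq> g x}) / real (card (Fpn p n))"

definition far_from_deg :: "nat \<Rightarrow> nat \<Rightarrow> nat \<Rightarrow> real \<Rightarrow> (nat list \<Rightarrow> nat) \<Rightarrow> bool" where
  "far_from_deg p n d \<delta> f \<longleftrightarrow> (\<forall>g. is_fn p n g \<and> deg_le p n d g \<longrightarrow> rel_dist p n f g \<ge> \<delta>)"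

(* Tester actions; answers are nat option, None = erased symbol *)
datatype action = Query "nat list" | Decide bool

type_synonym hist = "(nat list \<times> nat option) list"

(* Randomized adaptive tester: history \<Rightarrow> distribution of next action.
   Adversary: history (all queries and answers so far) \<Rightarrow> set of points to erase
   after the latest query. E = set of currently erased points; k = remaining query budget. *)
fun exec :: "(hist \<Rightarrow> action pmf) \<Rightarrow> (hist \<Rightarrow> nat list set) \<Rightarrow> (nat list \<Rightarrow> nat)
             \<Rightarrow> nat list set \<Rightarrow> hist \<Rightarrow> nat \<Rightarrow> bool pmf" where
  "exec T A f E h 0 = map_pmf (\<lambda>a. case a of Decide b \<Rightarrow> b | Query _ \<Rightarrow> False) (T h)"
| "exec T A f E h (Suc k) = bind_pmf (T h) (\<lambda>a. case a of
      Decide b \<Rightarrow> return_pmf b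
    | Query x \<Rightarrow> (let ans = (if x \<in> E then None else Some (f x));
                     h' = h @ [(x, ans)]
                 in exec T A f (E \<union> A h') h' k))"

definition valid_adversary :: "nat \<Rightarrow> (hist \<Rightarrow> nat list set) \<Rightarrow> bool" where
  "valid_adversary t A \<longleftrightarrow> (\<forall>h. finite (A h) \<and> card (A h) \<le> t)"

definition query_bounded :: "(hist \<Rightarrow> action pmf) \<Rightarrow> nat \<Rightarrow> bool" where
  "query_bounded T q \<longleftrightarrow> (\<forall>h. length h \<ge> q \<longrightarrow> (\<forall>a\<in>set_pmf (T h). \<exists>b. a = Decide b))"

definition accept_prob :: "(hist \<Rightarrow> action pmf) \<Rightarrow> nat \<Rightarrow> (hist \<Rightarrow> nat list set) \<Rightarrow> (nat list \<Rightarrow> nat) \<Rightarrow> real" where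
  "accept_prob T q A f = measure_pmf.prob (exec T A f {} [] q) {True}"

definition reject_prob :: "(hist \<Rightarrow> action pmf) \<Rightarrow> nat \<Rightarrow> (hist \<Rightarrow> nat list set) \<Rightarrow> (nat list \<Rightarrow> nat) \<Rightarrow> real" where
  "reject_prob T q A f = measure_pmf.prob (exec T A f {} [] q) {False}"

end

theory Submission
  imports Defs "HOL-Library.Function_Algebras" "HOL-Number_Theory.Cong" "HOL-Real_Asymp.Real_Asymp"
begin

text \<open>
  Over a prime field, degree at most \<open>d\<close> means that all \<open>(d + 1)\<close>-fold additive derivatives vanish.
  Testing a random such derivative has soundness linear in the distance: if it rejects rarely,
  then taking the common vote \<open>f x \<mp> \<Delta>\<^sub>h f x\<close> over random directions \<open>h\<close> corrects \<open>f\<close> to a nearby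
  function all of whose derivatives vanish.

  To resist erasures, a block of queries consists of uniform points in the image of a random affine map
  \<open>F\<^sub>p\<^sup>r \<rightarrow> F\<^sub>p\<^sup>n\<close> with \<open>p\<^sup>r\<close> polynomial in \<open>t / \<delta>\<close>, so that erased points are rarely hit. A constant
  multiple of the number of monomials of such points determines a polynomial of degree \<open>d\<close> on
  \<open>F\<^sub>p\<^sup>r\<close>, and one further point then reveals a disagreement with probability at least the distance. Repeating \<open>O(1 / \<delta>)\<close> blocks and
  accepting iff some polynomial of degree \<open>d\<close> fits all answers gives the tester. If \<open>n\<close> is too small for
  \<open>r \<le> n\<close>, the points are taken uniformly from \<open>F\<^sub>p\<^sup>n\<close> itself, and the exponent \<open>1 / (20 d)\<close> in the bound
  on \<open>t\<close> leaves enough room.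
\<close>

section \<open>Local testability of vanishing derivatives\<close>

text \<open>An adversary that recognises a fixed pattern, such as the cube of a
  \<open>(d + 1)\<close>-fold derivative, can erase its missing points. A uniform point of an affine
  image stays unpredictable even to someone who knows the image, so the risk of meeting an erased
  point is governed by the number of erasures divided by \<open>p ^ r\<close>. It is not the
  distance from degree \<open>d\<close> that is carried over to a random image, but the rejection
  probability of the derivative test: differences of the restriction along unit vectors are
  differences of \<open>f\<close> along the random columns of the map. Soundness linear in the
  distance is what keeps the number of blocks at \<open>O(1 / \<delta>)\<close>. For fixed
  \<open>p\<close> and \<open>d\<close> there are \<open>O(r ^ d)\<close> monomials, and
  \<open>r\<close> is logarithmic in \<open>t / \<delta>\<close>. The condition
  \<open>r \<le> n\<close> can fail only for \<open>n\<close> below a threshold depending on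
  \<open>p\<close> and \<open>d\<close> alone, so the block size of the uniform tester is then
  bounded by a constant. Functions are integer valued on integer vectors and periodic modulo
  \<open>p\<close>: differences then live in a group type, and vanishing means divisibility by
  \<open>p\<close>.\<close>

definition avg :: "'a set \<Rightarrow> ('a \<Rightarrow> real) \<Rightarrow> real" where
  "avg S \<phi> = (\<Sum>x\<in>S. \<phi> x) / real (card S)"

definition lists_of :: "'a set \<Rightarrow> nat \<Rightarrow> 'a list set" where
  "lists_of X k = {xs. set xs \<subseteq> X \<and> length xs = k}"

lemma lists_of_0 [simp]: "lists_of X 0 = {[]}"
  by (auto simp: lists_of_def)

lemma finite_lists_of [simp]: "finite X \<Longrightarrow> finite (lists_of X k)"
  by (simp add: lists_of_def finite_lists_length_eq)

lemma card_lists_of: "finite X \<Longrightarrow> card (lists_of X k) = card X ^ k"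
  by (simp add: lists_of_def card_lists_length_eq)

lemma lists_of_eq_empty_iff: "lists_of X k = {} \<longleftrightarrow> X = {} \<and> k > 0"
proof (cases k)
  case (Suc m)
  have "replicate k x \<in> lists_of X k" if "x \<in> X" for x
    using that by (auto simp: lists_of_def)
  then have "lists_of X k \<noteq> {}" if "X \<noteq> {}" using that by blast
  then show ?thesis by (auto simp: lists_of_def Suc)
qed simp

lemma lists_of_Suc: "lists_of X (Suc k) = (\<lambda>(x, xs). x # xs) ` (X \<times> lists_of X k)"
  by (auto simp: lists_of_def length_Suc_conv)

lemma avg_cong: "(\<And>x. x \<in> S \<Longrightarrow> \<phi> x = \<psi> x) \<Longrightarrow> avg S \<phi> = avg S \<psi>"
  by (simp add: avg_def)

lemma avg_mono: "(\<And>x. x \<in> S \<Longrightarrow> \<phi> x \<le> \<psi> x) \<Longrightarrow> avg S \<phi> \<le> avg S \<psi>"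
  by (simp add: avg_def divide_right_mono sum_mono)

lemma avg_add: "avg S (\<lambda>x. \<phi> x + \<psi> x) = avg S \<phi> + avg S \<psi>"
  by (simp add: avg_def sum.distrib add_divide_distrib)

lemma avg_diff: "avg S (\<lambda>x. \<phi> x - \<psi> x) = avg S \<phi> - avg S \<psi>"
  by (simp add: avg_def sum_subtractf diff_divide_distrib)

lemma avg_cmult: "avg S (\<lambda>x. c * \<phi> x) = c * avg S \<phi>"
  by (simp add: avg_def sum_distrib_left)

lemma avg_sum: "avg S (\<lambda>x. \<Sum>z\<in>Z. \<phi> z x) = (\<Sum>z\<in>Z. avg S (\<phi> z))"
  unfolding avg_def by (subst sum.swap) (simp add: sum_divide_distrib)

lemma avg_const [simp]: "finite S \<Longrightarrow> S \<noteq> {} \<Longrightarrow> avg S (\<lambda>_. c) = c"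
  by (simp add: avg_def)

lemma avg_singleton [simp]: "avg {a} \<phi> = \<phi> a"
  by (simp add: avg_def)

lemma avg_nonneg: "(\<And>x. x \<in> S \<Longrightarrow> 0 \<le> \<phi> x) \<Longrightarrow> 0 \<le> avg S \<phi>"
  by (simp add: avg_def sum_nonneg)

lemma avg_le_const: "finite S \<Longrightarrow> S \<noteq> {} \<Longrightarrow> (\<And>x. x \<in> S \<Longrightarrow> \<phi> x \<le> c) \<Longrightarrow> avg S \<phi> \<le> c"
  using avg_mono[of S \<phi> "\<lambda>_. c"] by simp

lemma ex_le_avg:
  assumes "finite S" "S \<noteq> {}" shows "\<exists>x\<in>S. \<phi> x \<le> avg S \<phi>"
proof (rule ccontr)
  assume "\<not> ?thesis"
  then have "(\<Sum>x\<in>S. avg S \<phi>) < (\<Sum>x\<in>S. \<phi> x)"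
    using assms by (intro sum_strict_mono) auto
  then show False using assms by (simp add: avg_def)
qed

lemma avg_of_bool_le_1: "avg S (\<lambda>x. of_bool (P x)) \<le> 1"
proof (cases "finite S \<and> S \<noteq> {}")
  case True
  then show ?thesis by (intro avg_le_const) auto
next
  case False
  then show ?thesis by (auto simp: avg_def)
qed

lemma avg_swap: "avg A (\<lambda>x. avg B (\<lambda>y. \<phi> x y)) = avg B (\<lambda>y. avg A (\<lambda>x. \<phi> x y))"
  unfolding avg_def by (simp add: sum_divide_distrib[symmetric]) (subst sum.swap, simp)

lemma avg_swap23: "avg A (\<lambda>x. avg B (\<lambda>y. avg C (\<lambda>z. \<phi> x y z))) = avg A (\<lambda>x. avg C (\<lambda>z. avg B (\<lambda>y. \<phi> x y z)))"
  by (intro avg_cong avg_swap)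

lemma avg_rot: "avg A (\<lambda>x. avg B (\<lambda>y. avg C (\<lambda>z. \<phi> x y z))) = avg B (\<lambda>y. avg C (\<lambda>z. avg A (\<lambda>x. \<phi> x y z)))"
  by (rule trans[OF avg_swap avg_swap23])

lemma avg_swap13: "avg A (\<lambda>x. avg B (\<lambda>y. avg C (\<lambda>z. \<phi> x y z))) = avg C (\<lambda>z. avg B (\<lambda>y. avg A (\<lambda>x. \<phi> x y z)))"
  by (rule trans[OF avg_rot avg_swap])

lemma avg_Times: "avg (A \<times> B) \<phi> = avg A (\<lambda>x. avg B (\<lambda>y. \<phi> (x, y)))"
  unfolding avg_def
  by (simp add: sum.cartesian_product card_cartesian_product sum_divide_distrib[symmetric])

lemma avg_reindex: "bij_betw h A B \<Longrightarrow> avg B \<phi> = avg A (\<lambda>x. \<phi> (h x))"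
  unfolding avg_def by (simp add: sum.reindex_bij_betw bij_betw_same_card)

lemma avg_lists_Suc:
  "avg (lists_of X (Suc k)) \<phi> = avg X (\<lambda>x. avg (lists_of X k) (\<lambda>xs. \<phi> (x # xs)))"
proof -
  have "bij_betw (\<lambda>(x, xs). x # xs) (X \<times> lists_of X k) (lists_of X (Suc k))"
    unfolding lists_of_Suc by (rule inj_on_imp_bij_betw) (auto simp: inj_on_def)
  from avg_reindex[OF this, of \<phi>] show ?thesis by (simp add: avg_Times)
qed

lemma avg_of_bool_disj:
  "(\<And>x. x \<in> S \<Longrightarrow> P x \<Longrightarrow> Q x \<or> R x) \<Longrightarrow>
   avg S (\<lambda>x. of_bool (P x)) \<le> avg S (\<lambda>x. of_bool (Q x)) + avg S (\<lambda>x. of_bool (R x))"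
  unfolding avg_add[symmetric] by (rule avg_mono) auto

lemma of_bool_not_le: "(P \<Longrightarrow> Q \<Longrightarrow> R) \<Longrightarrow> of_bool (\<not> R) \<le> (of_bool (\<not> P) + of_bool (\<not> Q) :: real)"
  by auto

section \<open>Iterated differences and the cubes on which they are supported\<close>

fun deriv_list :: "'a::ab_group_add list \<Rightarrow> ('a \<Rightarrow> int) \<Rightarrow> 'a \<Rightarrow> int" where
  "deriv_list [] f x = f x"
| "deriv_list (h # hs) f x = deriv_list hs f (x + h) - deriv_list hs f x"

fun cube :: "'a::ab_group_add list \<Rightarrow> 'a \<Rightarrow> 'a set" where
  "cube [] x = {x}"
| "cube (h # hs) x = cube hs (x + h) \<union> cube hs x"

text \<open>The positions of the cube other than its base vertex. The point \<open>x\<close> itself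
  can still occur when a nonempty sum of directions is zero.\<close>

fun punctured_cube :: "'a::ab_group_add list \<Rightarrow> 'a \<Rightarrow> 'a set" where
  "punctured_cube [] x = {}"
| "punctured_cube (h # hs) x = cube hs (x + h) \<union> punctured_cube hs x"

lemma deriv_list_diff:
  "deriv_list hs (\<lambda>x. f x - g x) x = deriv_list hs f x - deriv_list hs g x"
  by (induction hs arbitrary: x) auto

lemma deriv_list_add:
  "deriv_list hs (\<lambda>x. f x + g x) x = deriv_list hs f x + deriv_list hs g x"
  by (induction hs arbitrary: x) auto

lemma deriv_list_cmult: "deriv_list hs (\<lambda>x. c * f x) x = c * deriv_list hs f x"
  by (induction hs arbitrary: x) (auto simp: algebra_simps)

lemma deriv_list_sum:
  "finite S \<Longrightarrow> deriv_list hs (\<lambda>x. \<Sum>e\<in>S. F e x) x = (\<Sum>e\<in>S. deriv_list hs (F e) x)"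
  by (induction hs arbitrary: x) (auto simp: sum_subtractf)

lemma deriv_list_shift: "deriv_list hs (\<lambda>x. f (x + c)) x = deriv_list hs f (x + c)"
  by (induction hs arbitrary: x) (auto simp: algebra_simps)

lemma deriv_list_single: "deriv_list [h] f = (\<lambda>x. f (x + h) - f x)"
  by (rule ext) simp

lemma deriv_list_append: "deriv_list (as @ bs) f x = deriv_list as (deriv_list bs f) x"
  by (induction as arbitrary: x) auto

text \<open>By definition the head of the list is the outermost difference. Moving it innermost lets
  an induction on the list replace \<open>f\<close> by its difference along
  \<open>h\<close>.\<close>

lemma deriv_list_Cons_inner: "deriv_list (h # hs) f x = deriv_list hs (deriv_list [h] f) x"
  by (simp add: deriv_list_single deriv_list_diff deriv_list_shift)

lemma deriv_list_commute:
  "deriv_list as (deriv_list bs f) x = deriv_list bs (deriv_list as f) x"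
proof (induction as arbitrary: f)
  case Nil
  have "deriv_list [] g = g" for g :: "'a \<Rightarrow> int" by (rule ext) simp
  then show ?case by simp
next
  case (Cons a as)
  have eq: "deriv_list (a # as) f = deriv_list as (deriv_list [a] f)" for f :: "'a \<Rightarrow> int"
    by (rule ext) (rule deriv_list_Cons_inner)
  have "deriv_list [a] (deriv_list bs f) = deriv_list bs (deriv_list [a] f)"
    by (rule ext) (simp add: deriv_list_single deriv_list_diff deriv_list_shift)
  then show ?case by (simp only: eq Cons.IH)
qed

lemma deriv_list_cong:
  assumes "\<forall>z\<in>cube hs x. q dvd f z - g z"
  shows "q dvd deriv_list hs f x - deriv_list hs g x"
  using assms
proof (induction hs arbitrary: x)
  case (Cons h hs)
  have "q dvd (deriv_list hs f (x + h) - deriv_list hs g (x + h))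
      - (deriv_list hs f x - deriv_list hs g x)"
    using Cons by (intro dvd_diff[of q "_ - _" "_ - _"]) auto
  then show ?case by (simp add: algebra_simps)
qed auto

text \<open>In the alternating sum over the cube, the base point carries the sign
  \<open>(-1) ^ length hs\<close>; all other terms are divisible by \<open>q\<close>.\<close>

lemma deriv_list_punctured:
  assumes "\<forall>z\<in>punctured_cube hs x. q dvd f z"
  shows "q dvd deriv_list hs f x - (-1) ^ length hs * f x"
  using assms
proof (induction hs arbitrary: x)
  case (Cons h hs)
  have "q dvd deriv_list hs f (x + h) - deriv_list hs (\<lambda>_. 0) (x + h)"
    using Cons.prems by (intro deriv_list_cong) auto
  moreover have "deriv_list hs (\<lambda>_. 0) y = 0" for y :: 'a by (induction hs arbitrary: y) auto
  ultimately have "q dvd deriv_list hs f (x + h) - (deriv_list hs f x - (-1) ^ length hs * f x)"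
    using Cons by (intro dvd_diff[of q _ "_ - _"]) auto
  then show ?case by (simp add: algebra_simps)
qed auto

lemma card_cube: "finite (cube hs x) \<and> card (cube hs x) \<le> 2 ^ length hs"
proof (induction hs arbitrary: x)
  case (Cons h hs)
  have "card (cube (h # hs) x) \<le> card (cube hs (x + h)) + card (cube hs x)"
    by (simp add: card_Un_le)
  also have "\<dots> \<le> 2 ^ length (h # hs)"
    using Cons[of "x + h"] Cons[of x] by simp
  finally show ?case using Cons by simp
qed auto

section \<open>Finite quotient groups given by canonical representatives\<close>

text \<open>The space of dimension \<open>n\<close> over the prime field would be a type depending
  on \<open>n\<close>. Instead, the ambient group is a fixed type, \<open>X\<close> is a set of
  coset representatives, and functions on the quotient are the periodic ones.\<close>

locale reduction =
  fixes X :: "'a::ab_group_add set" and red :: "'a \<Rightarrow> 'a"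
  assumes finite_X [simp]: "finite X"
    and red_in [simp]: "red a \<in> X"
    and red_id: "x \<in> X \<Longrightarrow> red x = x"
    and red_add: "red (red a + b) = red (a + b)"
begin

definition periodic :: "('a \<Rightarrow> 'b) \<Rightarrow> bool" where
  "periodic \<phi> \<longleftrightarrow> (\<forall>x. \<phi> (red x) = \<phi> x)"

lemma X_nonempty [simp]: "X \<noteq> {}" using red_in by blast

lemma lists_nonempty [simp]: "lists_of X k \<noteq> {}" by (simp add: lists_of_eq_empty_iff)

lemma red_add2: "red (a + red b) = red (a + b)"
  using red_add[of b a] by (simp add: add.commute)

lemma red_red [simp]: "red (red a) = red a"
  by (simp add: red_id)

lemma bij_shift: "bij_betw (\<lambda>x. red (x + c)) X X"
proof (rule bij_betw_byWitness[where f' = "\<lambda>x. red (x - c)"])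
  show "\<forall>a\<in>X. red (red (a + c) - c) = a"
    using red_add[of "_ + c" "- c"] by (auto simp: red_id)
  show "\<forall>a\<in>X. red (red (a - c) + c) = a"
    by (auto simp: red_id red_add)
qed auto

lemma avg_shift: "periodic \<phi> \<Longrightarrow> avg X (\<lambda>x. \<phi> (x + c)) = avg X \<phi>"
  using avg_reindex[OF bij_shift[of c], of \<phi>] by (simp add: periodic_def)

lemma periodic_shift: "periodic \<phi> \<Longrightarrow> periodic (\<lambda>x. \<phi> (x + c))"
  unfolding periodic_def by (metis red_add)

lemma periodic_deriv_list:
  "periodic f \<Longrightarrow> periodic (deriv_list hs f)"
proof (induction hs)
  case (Cons h hs)
  then have "periodic (deriv_list hs f)" by simp
  then show ?case using periodic_shift[of "deriv_list hs f" h] by (simp add: periodic_def)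
qed (simp add: periodic_def)

lemma deriv_list_red: "periodic f \<Longrightarrow> deriv_list (red h # hs) f x = deriv_list (h # hs) f x"
  using periodic_deriv_list[of f hs] red_add2[of x h] unfolding periodic_def deriv_list.simps
  by metis

definition reject_prob_test :: "int \<Rightarrow> nat \<Rightarrow> ('a \<Rightarrow> int) \<Rightarrow> real" where
  "reject_prob_test q k f =
     avg X (\<lambda>x. avg (lists_of X k) (\<lambda>hs. of_bool (\<not> q dvd deriv_list hs f x)))"

lemma reject_prob_test_Suc:
  "reject_prob_test q (Suc k) f = avg X (\<lambda>h. reject_prob_test q k (deriv_list [h] f))"
proof -
  have "reject_prob_test q (Suc k) f = avg X (\<lambda>x. avg X (\<lambda>h. avg (lists_of X k)
      (\<lambda>hs. of_bool (\<not> q dvd deriv_list hs (deriv_list [h] f) x))))"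
    unfolding reject_prob_test_def avg_lists_Suc by (subst deriv_list_Cons_inner) (rule refl)
  also have "\<dots> = avg X (\<lambda>h. reject_prob_test q k (deriv_list [h] f))"
    unfolding reject_prob_test_def by (rule avg_swap)
  finally show ?thesis .
qed

lemma reject_prob_test_nonneg: "0 \<le> reject_prob_test q k f"
  unfolding reject_prob_test_def by (intro avg_nonneg) simp

lemma periodic_pred:
  "periodic f \<Longrightarrow> periodic (\<lambda>x. of_bool (\<not> q dvd deriv_list hs f x) :: real)"
  using periodic_deriv_list[of f hs] by (simp add: periodic_def)

text \<open>Replacing the directions one at a time: each replacement changes the derivative at the fixed
  point \<open>x\<close> by a derivative along uniformly random data.\<close>
lemma votes_agree:
  assumes "periodic f"
  shows "avg (lists_of X k) (\<lambda>hs. avg (lists_of X k) (\<lambda>hs'.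
      of_bool (\<not> q dvd deriv_list hs f x - deriv_list hs' f x))) \<le> k * reject_prob_test q k f"
  using assms
proof (induction k arbitrary: f)
  case 0
  show ?case by (simp add: avg_def)
next
  case (Suc k)
  let ?L = "lists_of X k"
  have per: "periodic (\<lambda>h. of_bool (\<not> q dvd deriv_list (h # hs) f y) :: real)" for hs y
    by (subst periodic_def) (simp only: deriv_list_red[OF Suc.prems] simp_thms)
  have "avg (lists_of X (Suc k)) (\<lambda>hs. avg (lists_of X (Suc k)) (\<lambda>hs'.
      of_bool (\<not> q dvd deriv_list hs f x - deriv_list hs' f x)))
    = avg X (\<lambda>h. avg ?L (\<lambda>hs. avg X (\<lambda>h'. avg ?L (\<lambda>hs'.
      of_bool (\<not> q dvd deriv_list (h # hs) f x - deriv_list (h' # hs') f x)))))"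
    unfolding avg_lists_Suc by (rule refl)
  also have "\<dots> \<le> avg X (\<lambda>h. avg ?L (\<lambda>hs. avg X (\<lambda>h'. avg ?L (\<lambda>hs'.
      of_bool (\<not> q dvd deriv_list ((h - h') # hs) f (x + h')) +
      of_bool (\<not> q dvd deriv_list hs (deriv_list [h'] f) x - deriv_list hs' (deriv_list [h'] f) x)))))"
  proof (intro avg_mono)
    fix h hs h' hs'
    \<comment> \<open>The first summand has direction \<open>h - h'\<close> and base point
      \<open>x + h'\<close>, which are jointly uniform, so it costs one rejection probability. The
      second is the same comparison one dimension lower, for the difference of \<open>f\<close>
      along \<open>h'\<close>.\<close>
    have eq: "deriv_list (h # hs) f x - deriv_list (h' # hs') f x
      = deriv_list ((h - h') # hs) f (x + h')
        + (deriv_list hs (deriv_list [h'] f) x - deriv_list hs' (deriv_list [h'] f) x)"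
      unfolding deriv_list_Cons_inner[symmetric] by (simp add: algebra_simps)
    show "of_bool (\<not> q dvd deriv_list (h # hs) f x - deriv_list (h' # hs') f x)
      \<le> (of_bool (\<not> q dvd deriv_list ((h - h') # hs) f (x + h')) +
      of_bool (\<not> q dvd deriv_list hs (deriv_list [h'] f) x - deriv_list hs' (deriv_list [h'] f) x) :: real)"
      by (rule of_bool_not_le) (simp only: eq dvd_add)
  qed
  also have "\<dots> = avg X (\<lambda>h. avg ?L (\<lambda>hs. avg X (\<lambda>h'.
      of_bool (\<not> q dvd deriv_list ((h - h') # hs) f (x + h'))))) +
      avg ?L (\<lambda>hs. avg X (\<lambda>h'. avg ?L (\<lambda>hs'.
      of_bool (\<not> q dvd deriv_list hs (deriv_list [h'] f) x - deriv_list hs' (deriv_list [h'] f) x))))"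
    by (simp only: avg_add avg_const finite_X X_nonempty finite_lists_of lists_nonempty simp_thms)
  also have "avg X (\<lambda>h. avg ?L (\<lambda>hs. avg X (\<lambda>h'.
      of_bool (\<not> q dvd deriv_list ((h - h') # hs) f (x + h')))))
    = avg X (\<lambda>h'. avg ?L (\<lambda>hs. avg X (\<lambda>h.
      of_bool (\<not> q dvd deriv_list ((h + - h') # hs) f (x + h')))))"
    unfolding diff_conv_add_uminus by (rule avg_swap13)
  also have "\<dots> = avg X (\<lambda>h'. avg ?L (\<lambda>hs. avg X (\<lambda>h.
      of_bool (\<not> q dvd deriv_list (h # hs) f (h' + x)))))"
    unfolding add.commute[of x] by (rule avg_cong, rule avg_cong, rule avg_shift[OF per])
  also have "\<dots> = avg ?L (\<lambda>hs. avg X (\<lambda>h. avg X (\<lambda>h'.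
      of_bool (\<not> q dvd deriv_list (h # hs) f (h' + x)))))"
    by (rule avg_rot)
  also have "\<dots> = avg ?L (\<lambda>hs. avg X (\<lambda>h. avg X (\<lambda>h'.
      of_bool (\<not> q dvd deriv_list (h # hs) f h'))))"
    by (rule avg_cong, rule avg_cong, rule avg_shift[OF periodic_pred[OF Suc.prems]])
  also have "\<dots> = reject_prob_test q (Suc k) f"
    unfolding reject_prob_test_def avg_lists_Suc by (rule avg_swap13)
  also have "avg ?L (\<lambda>hs. avg X (\<lambda>h'. avg ?L (\<lambda>hs'.
      of_bool (\<not> q dvd deriv_list hs (deriv_list [h'] f) x - deriv_list hs' (deriv_list [h'] f) x))))
     = avg X (\<lambda>h'. avg ?L (\<lambda>hs. avg ?L (\<lambda>hs'.
      of_bool (\<not> q dvd deriv_list hs (deriv_list [h'] f) x - deriv_list hs' (deriv_list [h'] f) x))))"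
    by (rule avg_swap)
  also have "\<dots> \<le> avg X (\<lambda>h'. k * reject_prob_test q k (deriv_list [h'] f))"
    by (rule avg_mono, rule Suc.IH[OF periodic_deriv_list[OF Suc.prems]])
  also have "\<dots> = k * reject_prob_test q (Suc k) f"
    unfolding reject_prob_test_Suc[of q k f] by (rule avg_cmult)
  finally show ?case by (simp add: algebra_simps)
qed

text \<open>A difference along a fixed \<open>h\<close> is a difference along \<open>u + h\<close>
  minus a shifted difference along \<open>u\<close>. For random \<open>u\<close> both directions are
  uniform, so making one direction arbitrary costs a factor 2.\<close>

lemma reject_fixed_directions:
  assumes "periodic f"
  shows "avg X (\<lambda>y. of_bool (\<not> q dvd deriv_list hs f y)) \<le> 2 ^ length hs * reject_prob_test q (length hs) f"
  using assms
proof (induction hs arbitrary: f)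
  case Nil
  show ?case by (simp add: reject_prob_test_def)
next
  case (Cons h hs)
  let ?k = "length hs" and ?L = "lists_of X (length hs)"
  have per: "periodic (\<lambda>h. of_bool (\<not> q dvd deriv_list (h # hs) f y) :: real)" for hs y
    by (subst periodic_def) (simp only: deriv_list_red[OF Cons.prems] simp_thms)
  have "reject_prob_test q ?k (deriv_list [h] f)
      = avg X (\<lambda>u. avg X (\<lambda>y. avg ?L (\<lambda>hs. of_bool (\<not> q dvd deriv_list (h # hs) f y))))"
    unfolding reject_prob_test_def deriv_list_Cons_inner[of h, symmetric] by (simp only: avg_const finite_X X_nonempty simp_thms)
  also have "\<dots> \<le> avg X (\<lambda>u. avg X (\<lambda>y. avg ?L (\<lambda>hs.
      of_bool (\<not> q dvd deriv_list ((u + h) # hs) f y) + of_bool (\<not> q dvd deriv_list (u # hs) f (y + h)))))"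
  proof (intro avg_mono)
    fix u y hs
    have eq: "deriv_list (h # hs) f y = deriv_list ((u + h) # hs) f y - deriv_list (u # hs) f (y + h)"
      by (simp add: algebra_simps)
    show "of_bool (\<not> q dvd deriv_list (h # hs) f y) \<le>
      (of_bool (\<not> q dvd deriv_list ((u + h) # hs) f y) + of_bool (\<not> q dvd deriv_list (u # hs) f (y + h)) :: real)"
      by (rule of_bool_not_le) (simp only: eq dvd_diff)
  qed
  also have "\<dots> = avg X (\<lambda>u. avg X (\<lambda>y. avg ?L (\<lambda>hs. of_bool (\<not> q dvd deriv_list ((u + h) # hs) f y))))
     + avg X (\<lambda>u. avg X (\<lambda>y. avg ?L (\<lambda>hs. of_bool (\<not> q dvd deriv_list (u # hs) f (y + h)))))"
    by (simp add: avg_add)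
  also have "avg X (\<lambda>u. avg X (\<lambda>y. avg ?L (\<lambda>hs. of_bool (\<not> q dvd deriv_list ((u + h) # hs) f y))))
    = avg X (\<lambda>y. avg ?L (\<lambda>hs. avg X (\<lambda>u. of_bool (\<not> q dvd deriv_list ((u + h) # hs) f y))))"
    by (rule avg_rot)
  also have "\<dots> = avg X (\<lambda>y. avg ?L (\<lambda>hs. avg X (\<lambda>u. of_bool (\<not> q dvd deriv_list (u # hs) f y))))"
    by (rule avg_cong, rule avg_cong, rule avg_shift[OF per])
  also have "\<dots> = reject_prob_test q (Suc ?k) f"
    unfolding reject_prob_test_def avg_lists_Suc by (rule avg_swap23)
  also have "avg X (\<lambda>u. avg X (\<lambda>y. avg ?L (\<lambda>hs. of_bool (\<not> q dvd deriv_list (u # hs) f (y + h)))))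
     = avg X (\<lambda>u. avg ?L (\<lambda>hs. avg X (\<lambda>y. of_bool (\<not> q dvd deriv_list (u # hs) f (y + h)))))"
    by (rule avg_swap23)
  also have "\<dots> = avg X (\<lambda>u. avg ?L (\<lambda>hs. avg X (\<lambda>y. of_bool (\<not> q dvd deriv_list (u # hs) f y))))"
    by (rule avg_cong, rule avg_cong, rule avg_shift[OF periodic_pred[OF Cons.prems]])
  also have "\<dots> = reject_prob_test q (Suc ?k) f"
    unfolding reject_prob_test_def avg_lists_Suc by (rule avg_rot[symmetric])
  finally have *: "reject_prob_test q ?k (deriv_list [h] f) \<le> 2 * reject_prob_test q (Suc ?k) f"
    by linarith
  have "avg X (\<lambda>y. of_bool (\<not> q dvd deriv_list (h # hs) f y))
     \<le> 2 ^ ?k * reject_prob_test q ?k (deriv_list [h] f)"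
    by (subst deriv_list_Cons_inner) (rule Cons.IH[OF periodic_deriv_list[OF Cons.prems]])
  also have "\<dots> \<le> 2 ^ ?k * (2 * reject_prob_test q (Suc ?k) f)"
    using * by (intro mult_left_mono) auto
  finally show ?case by simp
qed

text \<open>For fixed directions every point of the cube is a translate of the uniform
  \<open>x\<close>; this is the union bound over \<open>2 ^ length hs\<close> positions.\<close>

lemma cube_hits:
  assumes "periodic B"
  shows "avg X (\<lambda>x. of_bool (\<exists>z\<in>cube hs x. B z)) \<le> 2 ^ length hs * avg X (\<lambda>x. of_bool (B x))"
proof (induction hs)
  case (Cons h hs)
  have per: "periodic (\<lambda>x. of_bool (\<exists>z\<in>cube hs x. B z) :: real)"
  proof -
    have "(\<exists>z\<in>cube hs (red x). B z) = (\<exists>z\<in>cube hs x. B z)" for x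
    proof (induction hs arbitrary: x)
      case (Cons h hs)
      have "(\<exists>z\<in>cube hs (red x + h). B z) = (\<exists>z\<in>cube hs (x + h). B z)"
        using Cons[of "red x + h"] Cons[of "x + h"] by (simp add: red_add)
      then show ?case using Cons by (simp add: bex_Un)
    qed (use assms in \<open>simp add: periodic_def\<close>)
    then show ?thesis by (simp add: periodic_def)
  qed
  have "avg X (\<lambda>x. of_bool (\<exists>z\<in>cube (h # hs) x. B z)) \<le>
     avg X (\<lambda>x. of_bool (\<exists>z\<in>cube hs (x + h). B z)) + avg X (\<lambda>x. of_bool (\<exists>z\<in>cube hs x. B z))"
    by (rule avg_of_bool_disj) auto
  also have "\<dots> = 2 * avg X (\<lambda>x. of_bool (\<exists>z\<in>cube hs x. B z))"
    using avg_shift[OF per, of h] by simp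
  finally show ?case using Cons by simp
qed simp

text \<open>Here \<open>x\<close> is fixed and the directions are random. Every position except the
  base vertex is \<open>x\<close> plus a nonempty sum of directions, hence uniform, and the union
  bound applies.\<close>

lemma punctured_cube_hits:
  assumes "periodic B"
  shows "avg (lists_of X k) (\<lambda>hs. of_bool (\<exists>z\<in>punctured_cube hs x. B z)) \<le> 2 ^ k * avg X (\<lambda>x. of_bool (B x))"
proof (induction k)
  case 0
  show ?case by (auto intro: avg_nonneg)
next
  case (Suc k)
  let ?L = "lists_of X k"
  have "avg (lists_of X (Suc k)) (\<lambda>hs. of_bool (\<exists>z\<in>punctured_cube hs x. B z))
    = avg ?L (\<lambda>hs. avg X (\<lambda>h. of_bool (\<exists>z\<in>punctured_cube (h # hs) x. B z)))"
    unfolding avg_lists_Suc by (rule avg_swap)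
  also have "\<dots> \<le> avg ?L (\<lambda>hs. avg X (\<lambda>h. of_bool (\<exists>z\<in>cube hs (h + x). B z)) +
      avg X (\<lambda>h. of_bool (\<exists>z\<in>punctured_cube hs x. B z)))"
    by (intro avg_mono avg_of_bool_disj) (auto simp: add.commute)
  also have "\<dots> \<le> avg ?L (\<lambda>hs. 2 ^ k * avg X (\<lambda>x. of_bool (B x)) +
      of_bool (\<exists>z\<in>punctured_cube hs x. B z))"
  proof (intro avg_mono add_mono)
    fix hs assume "hs \<in> ?L"
    then have len: "length hs = k" by (simp add: lists_of_def)
    have "avg X (\<lambda>h. of_bool (\<exists>z\<in>cube hs (h + x). B z)) = avg X (\<lambda>h. of_bool (\<exists>z\<in>cube hs h. B (z + x)))"
    proof (intro avg_cong arg_cong[where f = of_bool])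
      have "cube hs (h + x) = (\<lambda>z. z + x) ` cube hs h" for h
      proof (induction hs arbitrary: h)
        case (Cons a hs)
        have "h + x + a = (h + a) + x" by (simp add: algebra_simps)
        then show ?case by (simp only: cube.simps Cons image_Un)
      qed simp
      then show "(\<exists>z\<in>cube hs (h + x). B z) = (\<exists>z\<in>cube hs h. B (z + x))" for h by auto
    qed
    also have "\<dots> \<le> 2 ^ length hs * avg X (\<lambda>h. of_bool (B (h + x)))"
      by (rule cube_hits[OF periodic_shift[OF assms]])
    also have "avg X (\<lambda>h. of_bool (B (h + x)) :: real) = avg X (\<lambda>h. of_bool (B h))"
      using avg_shift[of "\<lambda>x. of_bool (B x)" x] assms by (simp add: periodic_def)
    finally show "avg X (\<lambda>h. of_bool (\<exists>z\<in>cube hs (h + x). B z)) \<le> 2 ^ k * avg X (\<lambda>x. of_bool (B x))"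
      by (simp add: len)
  qed simp
  also have "\<dots> = 2 ^ k * avg X (\<lambda>x. of_bool (B x)) + avg ?L (\<lambda>hs. of_bool (\<exists>z\<in>punctured_cube hs x. B z))"
    by (simp add: avg_add)
  finally show ?case using Suc by simp
qed

definition deriv_vanish :: "int \<Rightarrow> nat \<Rightarrow> ('a \<Rightarrow> int) \<Rightarrow> bool" where
  "deriv_vanish q k g \<longleftrightarrow> periodic g \<and> (\<forall>hs x. length hs = k \<longrightarrow> q dvd deriv_list hs g x)"

definition dist_mod :: "int \<Rightarrow> ('a \<Rightarrow> int) \<Rightarrow> ('a \<Rightarrow> int) \<Rightarrow> real" where
  "dist_mod q f g = avg X (\<lambda>x. of_bool (\<not> q dvd f x - g x))"

text \<open>The hypothesis \<open>small\<close> says that two error events cannot cover all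
  direction lists: a corrected value on one of the \<open>2 ^ k\<close> cube points differs from the
  vote (\<open>k * \<epsilon>\<close> per point), or one of the \<open>2 ^ k\<close> other terms is
  a nonzero derivative along fixed directions (\<open>2 ^ k * \<epsilon>\<close> each). A single
  good list then makes the derivative of \<open>g\<close> vanish with certainty.\<close>

theorem self_correction:
  fixes f :: "'a \<Rightarrow> int" and k :: nat and q :: int
  defines "\<epsilon> \<equiv> reject_prob_test q k f"
  assumes per: "periodic f" and k: "k > 0" and small: "2 ^ k * (real k + 2 ^ k) * \<epsilon> < 1"
  shows "\<exists>g. deriv_vanish q k g \<and> dist_mod q f g \<le> 2 * \<epsilon>"
proof -
  \<comment> \<open>The value at \<open>x\<close> that would make the derivative along
    \<open>hs\<close> vanish; the contribution of \<open>f x\<close> cancels, so only the other cube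
    points vote.\<close>
  define vote where "vote hs x = f x - (-1) ^ k * deriv_list hs f x" for hs x
  have vote_per: "vote hs (red x) = vote hs x" for hs x
    using per periodic_deriv_list[OF per, of hs] by (simp add: vote_def periodic_def)
  have \<epsilon>0: "0 \<le> \<epsilon>" by (simp add: \<epsilon>_def reject_prob_test_nonneg)
  have "\<exists>hs'\<in>lists_of X k. avg (lists_of X k) (\<lambda>hs. of_bool (\<not> q dvd deriv_list hs f x - deriv_list hs' f x)) \<le> k * \<epsilon>" for x
  proof -
    have "avg (lists_of X k) (\<lambda>hs'. avg (lists_of X k) (\<lambda>hs.
      of_bool (\<not> q dvd deriv_list hs f x - deriv_list hs' f x))) \<le> k * \<epsilon>"
      using votes_agree[OF per, of k q x] unfolding \<epsilon>_def
      by (subst avg_swap)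
    moreover have "\<exists>hs'\<in>lists_of X k. avg (lists_of X k) (\<lambda>hs.
        of_bool (\<not> q dvd deriv_list hs f x - deriv_list hs' f x))
      \<le> avg (lists_of X k) (\<lambda>hs'. avg (lists_of X k) (\<lambda>hs.
        of_bool (\<not> q dvd deriv_list hs f x - deriv_list hs' f x)))"
      by (rule ex_le_avg) auto
    ultimately show ?thesis by force
  qed
  then obtain best where best: "best x \<in> lists_of X k"
    "avg (lists_of X k) (\<lambda>hs. of_bool (\<not> q dvd deriv_list hs f x - deriv_list (best x) f x)) \<le> k * \<epsilon>" for x
    by metis
  \<comment> \<open>Choosing the directions at the representative of \<open>x\<close> makes
    \<open>g\<close> periodic.\<close>
  define g where "g x = vote (best (red x)) x" for x
  have g_per: "periodic g" by (simp add: periodic_def g_def vote_per)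
  have sgn: "q dvd (-1) ^ k * a \<longleftrightarrow> q dvd a" for a
    by (cases "even k") auto
  have g_vote: "avg (lists_of X k) (\<lambda>hs. of_bool (\<not> q dvd g x - vote hs x)) \<le> k * \<epsilon>" for x
  proof -
    have "g x - vote hs x = (-1) ^ k * (deriv_list hs f (red x) - deriv_list (best (red x)) f (red x))" for hs
      using periodic_deriv_list[OF per] by (simp add: g_def vote_def algebra_simps periodic_def)
    then show ?thesis using best(2)[of "red x"] by (simp add: sgn)
  qed
  have half: "k * \<epsilon> \<le> 1 / 2"
  proof -
    have "(2::real) ^ 1 \<le> 2 ^ k" using k by (intro power_increasing) auto
    then have "2 * (k * \<epsilon>) \<le> 2 ^ k * (k * \<epsilon>)"
      using \<epsilon>0 by (intro mult_right_mono) simp_all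
    also have "\<dots> \<le> 2 ^ k * ((k + 2 ^ k) * \<epsilon>)"
      using \<epsilon>0 by (intro mult_left_mono mult_right_mono) auto
    finally show ?thesis using small by (simp add: mult.assoc)
  qed
  have "q dvd deriv_list hs g x" if len: "length hs = k" for hs x
  proof (rule ccontr)
    assume bad: "\<not> q dvd deriv_list hs g x"
    define F where "F = deriv_list hs f"
    define B where "B y = (\<not> q dvd F y)" for y
    have F_per: "periodic F" unfolding F_def by (rule periodic_deriv_list[OF per])
    then have B_per: "periodic B" by (simp add: B_def periodic_def)
    \<comment> \<open>Differences along \<open>hs\<close> and \<open>as\<close> commute, so the
      derivative of the vote is itself a vote of \<open>F\<close>, that is, a signed sum of
      \<open>F\<close> over the punctured cube of \<open>as\<close>.\<close>
    have split: "(\<exists>z\<in>cube hs x. \<not> q dvd g z - vote as z) \<or> (\<exists>z\<in>punctured_cube as x. B z)"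
      if "as \<in> lists_of X k" for as
    proof (rule ccontr)
      assume contra: "\<not> ?thesis"
      have la: "length as = k" using that by (simp add: lists_of_def)
      have "q dvd deriv_list hs g x - deriv_list hs (vote as) x"
        by (rule deriv_list_cong) (use contra in auto)
      moreover have "q dvd deriv_list as F x - (-1) ^ length as * F x"
        by (rule deriv_list_punctured) (use contra in \<open>auto simp: B_def\<close>)
      moreover have "deriv_list hs (vote as) x = F x - (-1) ^ k * deriv_list as F x"
        unfolding F_def deriv_list_commute[of as] vote_def deriv_list_diff deriv_list_cmult by simp
      moreover have "F x - (-1) ^ k * deriv_list as F x = - ((-1) ^ k * (deriv_list as F x - (-1) ^ k * F x))"
        by (simp add: algebra_simps flip: power_add)
      ultimately have "q dvd deriv_list hs (vote as) x" by (simp add: sgn la)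
      with \<open>q dvd deriv_list hs g x - deriv_list hs (vote as) x\<close> have "q dvd deriv_list hs g x"
        by (simp add: dvd_diff_left_iff)
      with bad show False by simp
    qed
    have "1 = avg (lists_of X k) (\<lambda>as. of_bool True)" by simp
    also have "\<dots> \<le> avg (lists_of X k) (\<lambda>as. of_bool (\<exists>z\<in>cube hs x. \<not> q dvd g z - vote as z))
        + avg (lists_of X k) (\<lambda>as. of_bool (\<exists>z\<in>punctured_cube as x. B z))"
      using split by (intro avg_of_bool_disj) blast
    also have "avg (lists_of X k) (\<lambda>as. of_bool (\<exists>z\<in>cube hs x. \<not> q dvd g z - vote as z))
       \<le> avg (lists_of X k) (\<lambda>as. \<Sum>z\<in>cube hs x. of_bool (\<not> q dvd g z - vote as z))"
    proof (intro avg_mono)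
      fix as
      show "of_bool (\<exists>z\<in>cube hs x. \<not> q dvd g z - vote as z) \<le> (\<Sum>z\<in>cube hs x. of_bool (\<not> q dvd g z - vote as z) :: real)"
      proof (cases "\<exists>z\<in>cube hs x. \<not> q dvd g z - vote as z")
        case True
        then obtain z where "z \<in> cube hs x" "\<not> q dvd g z - vote as z" by blast
        then show ?thesis
          using member_le_sum[of z "cube hs x" "\<lambda>z. of_bool (\<not> q dvd g z - vote as z) :: real"] card_cube[of hs x]
          by auto
      qed (auto intro: sum_nonneg)
    qed
    also have "\<dots> = (\<Sum>z\<in>cube hs x. avg (lists_of X k) (\<lambda>as. of_bool (\<not> q dvd g z - vote as z)))"
      by (rule avg_sum)
    also have "\<dots> \<le> (\<Sum>z\<in>cube hs x. k * \<epsilon>)"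
      by (intro sum_mono g_vote)
    also have "\<dots> \<le> 2 ^ k * (k * \<epsilon>)"
    proof -
      have "real (card (cube hs x)) \<le> 2 ^ k" using card_cube[of hs x] len
        by (metis of_nat_le_iff of_nat_numeral of_nat_power)
      then show ?thesis using \<epsilon>0 by (simp add: mult_right_mono)
    qed
    also have "avg (lists_of X k) (\<lambda>as. of_bool (\<exists>z\<in>punctured_cube as x. B z)) \<le> 2 ^ k * avg X (\<lambda>x. of_bool (B x))"
      by (rule punctured_cube_hits[OF B_per])
    also have "avg X (\<lambda>x. of_bool (B x)) \<le> 2 ^ k * \<epsilon>"
      unfolding B_def F_def \<epsilon>_def using reject_fixed_directions[OF per, of q hs] len by simp
    finally show False using small by (simp add: algebra_simps)
  qed
  then have "deriv_vanish q k g" using g_per by (simp add: deriv_vanish_def)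
  moreover have "dist_mod q f g \<le> 2 * \<epsilon>"
  proof -
    \<comment> \<open>Where \<open>g\<close> differs from \<open>f\<close>, at least half of the
      direction lists vote differently from \<open>f x\<close>, that is, they see a nonzero
      derivative at \<open>x\<close>. Averaging over \<open>x\<close> gives the factor 2.\<close>
    have "of_bool (\<not> q dvd f x - g x) / 2 \<le> avg (lists_of X k) (\<lambda>hs. of_bool (\<not> q dvd deriv_list hs f x))" for x
    proof (cases "q dvd f x - g x")
      case False
      have "1 = avg (lists_of X k) (\<lambda>as. of_bool True)" by simp
      also have "\<dots> \<le> avg (lists_of X k) (\<lambda>hs. of_bool (\<not> q dvd g x - vote hs x)) +
          avg (lists_of X k) (\<lambda>hs. of_bool (\<not> q dvd deriv_list hs f x))"
      proof (rule avg_of_bool_disj, rule ccontr)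
        fix hs assume c: "\<not> (\<not> q dvd g x - vote hs x \<or> \<not> q dvd deriv_list hs f x)"
        then have "q dvd - (g x - vote hs x) + (-1) ^ k * deriv_list hs f x"
          by (intro dvd_add) (auto simp: sgn dvd_diff_commute)
        with False show False by (simp add: vote_def)
      qed
      finally show ?thesis using g_vote[of x] half False by simp
    qed (auto intro: avg_nonneg)
    then have "avg X (\<lambda>x. (1/2) * of_bool (\<not> q dvd f x - g x)) \<le> \<epsilon>"
      unfolding \<epsilon>_def reject_prob_test_def by (intro avg_mono) auto
    then show ?thesis unfolding avg_cmult dist_mod_def by simp
  qed
  ultimately show ?thesis by blast
qed

end

section \<open>Vanishing derivatives and polynomials over a prime field\<close>

text \<open>Exact vanishing over the integers, the right notion for integer polynomials before
  reduction modulo \<open>p\<close>. Order \<open>k\<close> corresponds to degree less than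
  \<open>k\<close>.\<close>

definition deriv_zero :: "nat \<Rightarrow> ('a::ab_group_add \<Rightarrow> int) \<Rightarrow> bool" where
  "deriv_zero k F \<longleftrightarrow> (\<forall>hs x. length hs = k \<longrightarrow> deriv_list hs F x = 0)"

lemma deriv_zero_0: "deriv_zero 0 F \<longleftrightarrow> (\<forall>x. F x = 0)"
  by (simp add: deriv_zero_def)

lemma deriv_zero_Suc: "deriv_zero (Suc k) F \<longleftrightarrow> (\<forall>h. deriv_zero k (\<lambda>x. F (x + h) - F x))"
proof -
  have "(\<forall>hs x. length hs = Suc k \<longrightarrow> deriv_list hs F x = 0) \<longleftrightarrow>
      (\<forall>h hs x. length hs = k \<longrightarrow> deriv_list (h # hs) F x = 0)"
    unfolding length_Suc_conv by blast
  then show ?thesis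
    unfolding deriv_zero_def by (auto simp: deriv_list_diff deriv_list_shift)
qed

lemma deriv_zero_zero: "deriv_zero k (\<lambda>_. 0)"
  by (induction k) (auto simp: deriv_zero_0 deriv_zero_Suc)

lemma deriv_zero_add: "deriv_zero k F \<Longrightarrow> deriv_zero k G \<Longrightarrow> deriv_zero k (\<lambda>x. F x + G x)"
  by (simp add: deriv_zero_def deriv_list_add)

lemma deriv_zero_shift: "deriv_zero k F \<Longrightarrow> deriv_zero k (\<lambda>x. F (x + c))"
  by (simp add: deriv_zero_def deriv_list_shift)

lemma deriv_zero_mono: "deriv_zero k F \<Longrightarrow> k \<le> l \<Longrightarrow> deriv_zero l F"
proof (induction k arbitrary: F l)
  case 0
  then have "F = (\<lambda>_. 0)" by (auto simp: deriv_zero_0)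
  then show ?case by (simp add: deriv_zero_zero)
next
  case (Suc k)
  then obtain m where "l = Suc m" "k \<le> m" by (metis Suc_le_D Suc_le_mono)
  with Suc show ?case by (auto simp: deriv_zero_Suc)
qed

text \<open>The discrete Leibniz rule writes the difference of \<open>u * v\<close> as two products,
  in each of which one factor has been differenced. Degrees \<open>a - 1\<close> and
  \<open>b - 1\<close> add up to \<open>a + b - 2\<close>, whence the order
  \<open>a + b - 1\<close>.\<close>

lemma deriv_zero_mult:
  "deriv_zero a u \<Longrightarrow> deriv_zero b v \<Longrightarrow> deriv_zero (a + b - 1) (\<lambda>x. u x * v x)"
proof (induction "a + b" arbitrary: a b u v rule: less_induct)
  case less
  show ?case
  proof (cases "a = 0 \<or> b = 0")
    case True
    then have "(\<lambda>x. u x * v x) = (\<lambda>_. 0)" using less.prems by (auto simp: deriv_zero_0)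
    then show ?thesis by (simp add: deriv_zero_zero)
  next
    case False
    then obtain a' b' where ab: "a = Suc a'" "b = Suc b'" by (metis not0_implies_Suc)
    have "deriv_zero (a' + b') (\<lambda>x. u (x + h) * v (x + h) - u x * v x)" for h
    proof -
      have "deriv_zero (a' + Suc b' - 1) (\<lambda>x. (u (x + h) - u x) * v (x + h))"
        using less.prems unfolding ab deriv_zero_Suc[of a']
        by (intro less.hyps) (auto simp: ab intro: deriv_zero_shift)
      moreover have "deriv_zero (Suc a' + b' - 1) (\<lambda>x. u x * (v (x + h) - v x))"
        using less.prems unfolding ab deriv_zero_Suc[of b']
        by (intro less.hyps) (auto simp: ab)
      ultimately have "deriv_zero (a' + b') (\<lambda>x. (u (x + h) - u x) * v (x + h) + u x * (v (x + h) - v x))"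
        by (intro deriv_zero_add) simp_all
      then show ?thesis by (simp add: algebra_simps)
    qed
    then show ?thesis by (simp add: ab deriv_zero_Suc)
  qed
qed

lemma deriv_zero_power: "deriv_zero 2 u \<Longrightarrow> deriv_zero (Suc e) (\<lambda>x. u x ^ e)"
proof (induction e)
  case 0
  then show ?case by (simp add: deriv_zero_Suc deriv_zero_0)
next
  case (Suc e)
  then show ?case using deriv_zero_mult[of 2 u "Suc e" "\<lambda>x. u x ^ e"] by simp
qed

lemma deriv_zero_prod:
  fixes u :: "nat \<Rightarrow> 'a::ab_group_add \<Rightarrow> int"
  assumes "\<And>i. deriv_zero (Suc (e i)) (u i)"
  shows "deriv_zero (Suc (\<Sum>i<n. e i)) (\<lambda>x. \<Prod>i<n. u i x)"
proof (induction n)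
  case 0
  then show ?case by (simp add: deriv_zero_Suc deriv_zero_0)
next
  case (Suc n)
  then show ?case using deriv_zero_mult[OF Suc assms[of n]] by simp
qed

lemma deriv_zero_coord: "deriv_zero 2 (\<lambda>x :: nat \<Rightarrow> int. x i)"
  by (simp add: numeral_2_eq_2 deriv_zero_Suc deriv_zero_0)

text \<open>The binomial theorem for the shift operator written as identity plus difference.\<close>

lemma newton_expansion:
  "g (((\<lambda>y. y + u) ^^ a) x) = (\<Sum>j\<le>a. int (a choose j) * deriv_list (replicate j u) g x)"
proof (induction a arbitrary: x)
  case 0
  then show ?case by simp
next
  case (Suc a)
  let ?D = "\<lambda>j x. deriv_list (replicate j u) g x"
  have "g (((\<lambda>y. y + u) ^^ Suc a) x) = g (((\<lambda>y. y + u) ^^ a) (x + u))"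
    by (simp only: funpow_Suc_right o_apply)
  also have "\<dots> = (\<Sum>j\<le>a. int (a choose j) * (?D j x + ?D (Suc j) x))"
    unfolding Suc by simp
  also have "\<dots> = (\<Sum>j\<le>a. int (a choose j) * ?D j x) + (\<Sum>j\<le>a. int (a choose j) * ?D (Suc j) x)"
    unfolding distrib_left sum.distrib ..
  also have "(\<Sum>j\<le>a. int (a choose j) * ?D j x) = ?D 0 x + (\<Sum>j\<le>a. int (a choose Suc j) * ?D (Suc j) x)"
  proof -
    have "(\<Sum>j\<le>a. int (a choose j) * ?D j x) = (\<Sum>j\<le>Suc a. int (a choose j) * ?D j x)" by simp
    also have "\<dots> = ?D 0 x + (\<Sum>j\<le>a. int (a choose Suc j) * ?D (Suc j) x)"
      by (subst sum.atMost_Suc_shift) simp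
    finally show ?thesis .
  qed
  also have "?D 0 x + (\<Sum>j\<le>a. int (a choose Suc j) * ?D (Suc j) x) + (\<Sum>j\<le>a. int (a choose j) * ?D (Suc j) x)
     = ?D 0 x + (\<Sum>j\<le>a. int (Suc a choose Suc j) * ?D (Suc j) x)"
    by (simp add: sum.distrib algebra_simps del: deriv_list.simps)
  also have "\<dots> = (\<Sum>j\<le>Suc a. int (Suc a choose j) * ?D j x)"
    by (subst sum.atMost_Suc_shift) simp
  finally show ?case .
qed

context reduction begin

text \<open>A nonzero value of the difference along \<open>h\<close> at \<open>x\<close> forces a
  nonzero value of \<open>g\<close> at \<open>x\<close> or at \<open>x + h\<close>, so each
  difference at most doubles the density of nonzeros. If all differences vanish, \<open>g\<close> is
  a nonzero constant modulo \<open>q\<close>.\<close>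

lemma nonzero_density:
  assumes "deriv_vanish q (Suc d) g" "\<exists>x. \<not> q dvd g x"
  shows "1 / 2 ^ d \<le> avg X (\<lambda>x. of_bool (\<not> q dvd g x))"
  using assms
proof (induction d arbitrary: g)
  case (Suc d)
  have per: "periodic g" using Suc.prems by (simp add: deriv_vanish_def)
  show ?case
  proof (cases "\<exists>h x. \<not> q dvd deriv_list [h] g x")
    case True
    then obtain h where h: "\<exists>x. \<not> q dvd deriv_list [h] g x" by blast
    have "deriv_vanish q (Suc d) (deriv_list [h] g)"
      unfolding deriv_vanish_def
    proof (intro conjI allI impI)
      fix hs x assume "length (hs :: 'a list) = Suc d"
      then have "q dvd deriv_list (hs @ [h]) g x"
        using Suc.prems(1) unfolding deriv_vanish_def by simp
      then show "q dvd deriv_list hs (deriv_list [h] g) x" by (simp only: deriv_list_append)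
    qed (rule periodic_deriv_list[OF per])
    then have "1 / 2 ^ d \<le> avg X (\<lambda>x. of_bool (\<not> q dvd deriv_list [h] g x))"
      using h by (rule Suc.IH)
    also have "\<dots> \<le> avg X (\<lambda>x. of_bool (\<not> q dvd g (x + h))) + avg X (\<lambda>x. of_bool (\<not> q dvd g x))"
      by (rule avg_of_bool_disj) (auto intro: dvd_diff)
    also have "avg X (\<lambda>x. of_bool (\<not> q dvd g (x + h)) :: real) = avg X (\<lambda>x. of_bool (\<not> q dvd g x))"
      using avg_shift[of "\<lambda>x. of_bool (\<not> q dvd g x)" h] per by (simp add: periodic_def)
    finally show ?thesis by (simp add: field_simps)
  next
    case False
    obtain x where x: "\<not> q dvd g x" using Suc.prems by blast
    have "\<not> q dvd g y" for y
    proof -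
      have "q dvd deriv_list [x - y] g y" using False by blast
      then have "q dvd g x - g y" by simp
      with x show ?thesis using dvd_add[of q "g x - g y" "g y"] by auto
    qed
    moreover have "1 / 2 ^ Suc d \<le> (1::real)" using one_le_power[of "2::real" "Suc d"] by simp
    ultimately show ?thesis by simp
  qed
next
  case 0
  obtain x where x: "\<not> q dvd g x" using 0 by blast
  have "\<not> q dvd g y" for y
  proof -
    have "q dvd deriv_list [x - y] g y" using 0(1) unfolding deriv_vanish_def by (metis length_Cons list.size(3))
    then have "q dvd g x - g y" by simp
    with x show ?thesis using dvd_add[of q "g x - g y" "g y"] by auto
  qed
  then show ?case by simp
qed

end

section \<open>Integer vectors modulo \<open>p\<close> as a model of the field space\<close>

definition vred :: "nat \<Rightarrow> nat \<Rightarrow> (nat \<Rightarrow> int) \<Rightarrow> nat \<Rightarrow> int" where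
  "vred p n x = (\<lambda>i. if i < n then x i mod int p else 0)"

definition vecs :: "nat \<Rightarrow> nat \<Rightarrow> (nat \<Rightarrow> int) set" where
  "vecs p n = {x. (\<forall>i<n. 0 \<le> x i \<and> x i < int p) \<and> (\<forall>i\<ge>n. x i = 0)}"

definition to_list :: "nat \<Rightarrow> nat \<Rightarrow> (nat \<Rightarrow> int) \<Rightarrow> nat list" where
  "to_list p n x = map (\<lambda>i. nat (x i mod int p)) [0..<n]"

definition of_list :: "nat list \<Rightarrow> nat \<Rightarrow> int" where
  "of_list xs = (\<lambda>i. if i < length xs then int (xs ! i) else 0)"

definition lift :: "nat \<Rightarrow> nat \<Rightarrow> (nat list \<Rightarrow> nat) \<Rightarrow> (nat \<Rightarrow> int) \<Rightarrow> int" where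
  "lift p n f x = int (f (to_list p n x))"

lemma Fpn_eq: "Fpn p n = lists_of {..<p} n"
  by (auto simp: Fpn_def lists_of_def)

lemma finite_Fpn [simp]: "finite (Fpn p n)" and card_Fpn: "card (Fpn p n) = p ^ n"
  by (simp_all add: Fpn_eq card_lists_of)

locale prime_mod =
  fixes p :: nat
  assumes prime_p: "prime p"
begin

lemma p_pos [simp]: "p > 0" and p_ge_2: "p \<ge> 2"
  using prime_p prime_gt_0_nat prime_ge_2_nat by auto

lemma bij_to_list: "bij_betw (to_list p n) (vecs p n) (Fpn p n)"
proof (rule bij_betw_byWitness[where f' = of_list])
  show "\<forall>a\<in>vecs p n. of_list (to_list p n a) = a"
    by (auto simp: vecs_def of_list_def to_list_def fun_eq_iff)
  show "\<forall>a'\<in>Fpn p n. to_list p n (of_list a') = a'"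
    by (auto simp: Fpn_def of_list_def to_list_def intro!: nth_equalityI)
  show "to_list p n ` vecs p n \<subseteq> Fpn p n"
    by (auto simp: Fpn_def to_list_def nat_less_iff)
  show "of_list ` Fpn p n \<subseteq> vecs p n"
    by (auto simp: Fpn_def of_list_def vecs_def)
qed

lemma to_list_in [simp]: "to_list p n x \<in> Fpn p n"
  by (auto simp: Fpn_def to_list_def nat_less_iff)

lemma finite_vecs [simp]: "finite (vecs p n)" and card_vecs: "card (vecs p n) = p ^ n"
  using bij_betw_finite[OF bij_to_list[of n]] bij_betw_same_card[OF bij_to_list[of n]]
  by (auto simp: card_Fpn)

sublocale V: reduction "vecs p n" "vred p n" for n
proof
  show "vred p n a \<in> vecs p n" for a by (auto simp: vred_def vecs_def)
  show "vred p n x = x" if "x \<in> vecs p n" for x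
    using that by (auto simp: vred_def vecs_def fun_eq_iff)
  show "vred p n (vred p n a + b) = vred p n (a + b)" for a b
    by (auto simp: vred_def fun_eq_iff mod_add_left_eq)
qed simp

lemma to_list_vred [simp]: "to_list p n (vred p n x) = to_list p n x"
  by (auto simp: to_list_def vred_def)

lemma lift_periodic: "V.periodic n (lift p n f)"
  by (simp add: V.periodic_def lift_def)

text \<open>The values of \<open>f\<close> are congruent to those of an integer polynomial
  \<open>P\<close> of degree at most \<open>d\<close>, whose derivatives of order
  \<open>d + 1\<close> are exactly zero; congruence passes to derivatives.\<close>

lemma deriv_vanish_lift:
  assumes "deg_le p n d f"
  shows "V.deriv_vanish n (int p) (Suc d) (lift p n f)"
  unfolding V.deriv_vanish_def
proof (intro conjI allI impI)
  show "V.periodic n (lift p n f)" by (rule lift_periodic)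
  fix hs :: "(nat \<Rightarrow> int) list" and x
  assume len: "length hs = Suc d"
  obtain C where C: "\<And>x. x \<in> Fpn p n \<Longrightarrow>
      f x = (\<Sum>e\<in>Fpn p n. if sum_list e \<le> d then C e * mono_eval x e else 0) mod p"
    using assms by (auto simp: deg_le_def)
  define P where "P x = (\<Sum>e\<in>{e \<in> Fpn p n. sum_list e \<le> d}. int (C e) * (\<Prod>i<n. x i ^ (e ! i)))" for x
  have "deriv_zero (Suc d) (\<lambda>x. int (C e) * (\<Prod>i<n. x i ^ (e ! i)))"
    if "e \<in> Fpn p n" "sum_list e \<le> d" for e
  proof -
    have "(\<Sum>i<n. e ! i) = sum_list e"
      using that by (simp add: Fpn_def sum_list_sum_nth atLeast0LessThan)
    moreover have "deriv_zero (Suc (\<Sum>i<n. e ! i)) (\<lambda>x :: nat \<Rightarrow> int. \<Prod>i<n. x i ^ (e ! i))"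
      by (rule deriv_zero_prod) (rule deriv_zero_power[OF deriv_zero_coord])
    ultimately have "deriv_zero (Suc d) (\<lambda>x :: nat \<Rightarrow> int. \<Prod>i<n. x i ^ (e ! i))"
      using that by (auto intro: deriv_zero_mono)
    then show ?thesis by (simp add: deriv_zero_def deriv_list_cmult)
  qed
  then have P0: "deriv_list hs P x = 0"
    unfolding P_def using len by (subst deriv_list_sum) (auto simp: deriv_zero_def)
  have "int p dvd lift p n f z - P z" for z
  proof -
    let ?l = "to_list p n z"
    have "int (mono_eval ?l e) mod int p = (\<Prod>i<n. z i ^ (e ! i)) mod int p" for e
    proof -
      have "int (mono_eval ?l e) = (\<Prod>i<n. (z i mod int p) ^ (e ! i))"
        by (simp add: mono_eval_def to_list_def)
      also have "\<dots> mod int p = (\<Prod>i<n. ((z i mod int p) ^ (e ! i)) mod int p) mod int p"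
        by (rule mod_prod_eq[symmetric])
      also have "\<dots> = (\<Prod>i<n. z i ^ (e ! i)) mod int p"
        by (simp add: power_mod mod_prod_eq)
      finally show ?thesis .
    qed
    then have *: "int (C e * mono_eval ?l e) mod int p = int (C e) * (\<Prod>i<n. z i ^ (e ! i)) mod int p" for e
      unfolding of_nat_mult by (rule mod_mult_cong[OF refl])
    have "f ?l = (\<Sum>e\<in>{e \<in> Fpn p n. sum_list e \<le> d}. C e * mono_eval ?l e) mod p"
      unfolding C[OF to_list_in] by (simp add: sum.inter_filter)
    then have "int (f ?l) = (\<Sum>e\<in>{e \<in> Fpn p n. sum_list e \<le> d}. int (C e * mono_eval ?l e) mod int p) mod int p"
      by (simp add: zmod_int mod_sum_eq)
    also have "\<dots> = P z mod int p"
      unfolding * P_def by (rule mod_sum_eq)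
    finally show ?thesis unfolding lift_def by (simp add: mod_eq_dvd_iff[symmetric])
  qed
  then have "int p dvd deriv_list hs (lift p n f) x - deriv_list hs P x"
    by (intro deriv_list_cong) auto
  then show "int p dvd deriv_list hs (lift p n f) x" by (simp add: P0)
qed

section \<open>From vanishing derivatives back to polynomials\<close>

text \<open>Below \<open>p\<close> the factorial of \<open>j\<close> is invertible, so the binomial
  coefficient is a polynomial of degree \<open>j\<close> in \<open>a\<close> modulo
  \<open>p\<close>. The induction follows the recursion that multiplies by \<open>a - j\<close> and
  divides by \<open>j + 1\<close>.\<close>

lemma binomial_poly:
  assumes "j < p"
  shows "\<exists>s :: nat \<Rightarrow> int. (\<forall>i>j. s i = 0) \<and> (\<forall>a. int p dvd int (a choose j) - (\<Sum>i<p. s i * int a ^ i))"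
  using assms
proof (induction j)
  case 0
  show ?case
  proof (intro exI conjI allI impI)
    show "(if i = 0 then 1 else 0) = (0::int)" if "i > 0" for i :: nat using that by simp
    show "int p dvd int (a choose 0) - (\<Sum>i<p. (if i = 0 then 1 else 0) * int a ^ i)" for a
      by (simp add: if_distrib if_distribR sum.delta cong: if_cong)
  qed
next
  case (Suc j)
  then obtain s :: "nat \<Rightarrow> int" where s: "\<And>i. i > j \<Longrightarrow> s i = 0"
    "\<And>a. int p dvd int (a choose j) - (\<Sum>i<p. s i * int a ^ i)" by auto
  have "\<not> p dvd Suc j" using Suc.prems by (auto dest: dvd_imp_le)
  then have "coprime p (Suc j)" using prime_p by (rule prime_imp_coprime[rotated])
  then have "coprime (int (Suc j)) (int p)" by (simp only: coprime_int_iff coprime_commute)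
  then obtain c where c: "[int (Suc j) * c = 1] (mod int p)"
    using coprime_iff_invertible_int by blast
  \<comment> \<open>Coefficients of \<open>c * (X - j)\<close> times the previous polynomial, with
    \<open>c\<close> an inverse of \<open>j + 1\<close>. The product keeps all exponents below
    \<open>p\<close> because \<open>Suc j < p\<close>.\<close>
  define s' where "s' i = c * ((if i = 0 then 0 else s (i - 1)) - int j * s i)" for i
  show ?case
  proof (intro exI[of _ s'] conjI allI impI)
    show "s' i = 0" if "i > Suc j" for i using that s(1) by (simp add: s'_def)
    fix a
    obtain p' where p': "p = Suc p'" using p_pos gr0_conv_Suc by blast
    have sp': "s p' = 0" using s(1) Suc.prems p' by simp
    have "(\<Sum>i<p. s' i * int a ^ i) = c * ((\<Sum>i<p. (if i = 0 then 0 else s (i - 1)) * int a ^ i) - int j * (\<Sum>i<p. s i * int a ^ i))"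
      by (simp add: s'_def sum_distrib_left sum_subtractf[symmetric] algebra_simps)
    also have "(\<Sum>i<p. (if i = 0 then 0 else s (i - 1)) * int a ^ i) = (\<Sum>i<p'. s i * int a ^ Suc i)"
      unfolding p' by (subst sum.lessThan_Suc_shift) simp
    also have "\<dots> = int a * (\<Sum>i<p. s i * int a ^ i)"
      unfolding p' by (simp add: sp' sum_distrib_left algebra_simps)
    finally have S: "(\<Sum>i<p. s' i * int a ^ i) = c * (int a - int j) * (\<Sum>i<p. s i * int a ^ i)"
      by (simp add: algebra_simps)
    have bin: "int (Suc j) * int (a choose Suc j) = (int a - int j) * int (a choose j)"
    proof (cases "j \<le> a")
      case True
      have "Suc j * (a choose Suc j) = (a - j) * (a choose j)"
        by (simp only: binomial_absorb_comp binomial_absorption)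
      then show ?thesis using True by (simp only: of_nat_diff[symmetric] of_nat_mult[symmetric])
    qed (simp add: binomial_eq_0)
    have alg: "B - c * (a' - j') * S = c * (a' - j') * (b - S) - (u * c - 1) * B"
      if "u * B = (a' - j') * b" for B a' j' b u S :: int
    proof -
      have "c * (a' - j') * b = c * (u * B)" using that by simp
      then show ?thesis by (simp add: right_diff_distrib left_diff_distrib mult_ac)
    qed
    have "int (a choose Suc j) - (\<Sum>i<p. s' i * int a ^ i)
      = c * (int a - int j) * (int (a choose j) - (\<Sum>i<p. s i * int a ^ i))
        - (int (Suc j) * c - 1) * int (a choose Suc j)"
      unfolding S by (rule alg[OF bin])
    moreover have "int p dvd int (Suc j) * c - 1" using c by (simp add: cong_iff_dvd_diff)
    ultimately show "int p dvd int (a choose Suc j) - (\<Sum>i<p. s' i * int a ^ i)"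
      using s(2)[of a] by (simp only: dvd_diff dvd_mult dvd_mult2)
  qed
qed

text \<open>The bound is strict, so that order \<open>0\<close> yields the zero polynomial and order
  \<open>Suc d\<close> means degree at most \<open>d\<close>.\<close>

definition low_exps :: "nat \<Rightarrow> nat \<Rightarrow> nat list set" where
  "low_exps m k = {e \<in> Fpn p m. sum_list e < k}"

definition poly_fun :: "nat \<Rightarrow> nat \<Rightarrow> (nat list \<Rightarrow> int) \<Rightarrow> (nat \<Rightarrow> int) \<Rightarrow> int" where
  "poly_fun m k C x = (\<Sum>e\<in>low_exps m k. C e * (\<Prod>i<m. x i ^ (e ! i)))"

text \<open>Induction on the number of variables: Newton expansion in the last coordinate around
  \<open>0\<close> has coefficients \<open>G j\<close>, whose derivatives of order
  \<open>k - j\<close> vanish. Each is a polynomial in the other variables, and the binomials in the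
  last coordinate become powers modulo \<open>p\<close>.\<close>

lemma poly_representation:
  assumes "\<And>hs x. length hs = k \<Longrightarrow> int p dvd deriv_list hs g x"
  shows "\<exists>C. \<forall>x\<in>vecs p m. int p dvd g x - poly_fun m k C x"
  using assms
proof (induction m arbitrary: k g)
  case 0
  show ?case
  proof (intro exI ballI)
    fix x assume "x \<in> vecs p 0"
    then have x: "x = (\<lambda>_. 0)" by (auto simp: vecs_def)
    show "int p dvd g x - poly_fun 0 k (\<lambda>_. g (\<lambda>_. 0)) x"
    proof (cases "k = 0")
      case True
      then show ?thesis using 0[of "[]"] by (simp add: poly_fun_def low_exps_def)
    next
      case False
      then have "low_exps 0 k = {[]}" by (auto simp: low_exps_def Fpn_def)
      then show ?thesis by (simp add: poly_fun_def x)
    qed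
  qed
next
  case (Suc m)
  define u :: "nat \<Rightarrow> int" where "u = (\<lambda>i. if i = m then 1 else 0)"
  define G where "G j = deriv_list (replicate j u) g" for j
  have "int p dvd deriv_list hs (G j) x" if "length hs = k - j" for hs j x
  proof -
    have eq: "deriv_list hs (G j) x = deriv_list (hs @ replicate j u) g x"
      by (simp add: G_def deriv_list_append)
    show ?thesis
    proof (cases "j \<le> k")
      case True
      then show ?thesis using that Suc.prems unfolding eq by simp
    next
      \<comment> \<open>For \<open>j > k\<close> the truncated difference \<open>k - j\<close> is
        \<open>0\<close>, and the claim is that \<open>G j\<close> itself vanishes: it is a further
        difference of a function divisible by \<open>p\<close>.\<close>
      case False
      then have "hs @ replicate j u = replicate (j - k) u @ replicate k u"
        using that by (simp flip: replicate_add)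
      then have "deriv_list hs (G j) x = deriv_list (replicate (j - k) u) (deriv_list (replicate k u) g) x"
        unfolding eq by (simp add: deriv_list_append)
      also have "int p dvd \<dots> - deriv_list (replicate (j - k) u) (\<lambda>_. 0) x"
        using Suc.prems by (intro deriv_list_cong) auto
      finally show ?thesis using deriv_zero_zero[where 'a = "nat \<Rightarrow> int", of "j - k"] by (simp add: deriv_zero_def)
    qed
  qed
  then have "\<exists>C. \<forall>x\<in>vecs p m. int p dvd G j x - poly_fun m (k - j) C x" for j
    by (rule Suc.IH)
  then obtain C where C: "\<And>j x. x \<in> vecs p m \<Longrightarrow> int p dvd G j x - poly_fun m (k - j) (C j) x"
    by metis
  have "\<exists>s. j < p \<longrightarrow> (\<forall>i>j. s i = 0) \<and> (\<forall>a. int p dvd int (a choose j) - (\<Sum>i<p. s i * int a ^ i))" for j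
    using binomial_poly[of j] by auto
  then obtain s where s0: "\<And>i j. j < p \<Longrightarrow> i > j \<Longrightarrow> s j i = 0"
    and s: "\<And>j a. j < p \<Longrightarrow> int p dvd int (a choose j) - (\<Sum>i<p. s j i * int a ^ i)"
    by metis
  define C' where "C' e' = (\<Sum>j<p. s j (last e') * (if sum_list (butlast e') < k - j then C j (butlast e') else 0))" for e'
  show ?case
  proof (intro exI[of _ C'] ballI)
    fix x assume x: "x \<in> vecs p (Suc m)"
    define a where "a = nat (x m)"
    define x' where "x' = x(m := 0)"
    have a: "x m = int a" "a < p" using x by (auto simp: a_def vecs_def nat_less_iff)
    have x'v: "x' \<in> vecs p m" using x by (auto simp: x'_def vecs_def)
    have it: "((\<lambda>y. y + u) ^^ b) x' = x'(m := int b)" for b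
      by (induction b) (auto simp: u_def x'_def fun_eq_iff)
    define T where "T i e j = s j i * (if sum_list e < k - j then C j e else 0) * int a ^ i * (\<Prod>i<m. x' i ^ (e ! i))" for i e j
    have "g x = g (((\<lambda>y. y + u) ^^ a) x')" unfolding it by (simp add: x'_def a(1)[symmetric])
    also have "\<dots> = (\<Sum>j\<le>a. int (a choose j) * G j x')" unfolding newton_expansion G_def ..
    also have "\<dots> = (\<Sum>j<p. int (a choose j) * G j x')"
      using a(2) by (intro sum.mono_neutral_left) (auto simp: binomial_eq_0)
    finally have g: "g x = (\<Sum>j<p. int (a choose j) * G j x')" .
    have "int p dvd (\<Sum>j<p. int (a choose j) * G j x' - (\<Sum>i<p. s j i * int a ^ i) * poly_fun m (k - j) (C j) x')"
    proof (rule dvd_sum)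
      fix j assume "j \<in> {..<p}"
      then have "[int (a choose j) = (\<Sum>i<p. s j i * int a ^ i)] (mod int p)" using s by (simp add: cong_iff_dvd_diff)
      moreover have "[G j x' = poly_fun m (k - j) (C j) x'] (mod int p)" using C[OF x'v] by (simp add: cong_iff_dvd_diff)
      ultimately show "int p dvd int (a choose j) * G j x' - (\<Sum>i<p. s j i * int a ^ i) * poly_fun m (k - j) (C j) x'"
        unfolding cong_iff_dvd_diff[symmetric] by (rule cong_mult)
    qed
    moreover have "(\<Sum>j<p. (\<Sum>i<p. s j i * int a ^ i) * poly_fun m (k - j) (C j) x') = poly_fun (Suc m) k C' x"
    proof -
      have P: "poly_fun m (k - j) (C j) x' = (\<Sum>e\<in>Fpn p m. (if sum_list e < k - j then C j e else 0) * (\<Prod>i<m. x' i ^ (e ! i)))" for j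
        unfolding poly_fun_def low_exps_def by (simp only: sum.inter_filter finite_Fpn) (intro sum.cong refl, simp)
      have "(\<Sum>j<p. (\<Sum>i<p. s j i * int a ^ i) * poly_fun m (k - j) (C j) x')
         = (\<Sum>j<p. \<Sum>i<p. \<Sum>e\<in>Fpn p m. T i e j)"
        unfolding P T_def sum_product by (intro sum.cong refl) (simp only: mult_ac)
      also have "\<dots> = (\<Sum>i<p. \<Sum>e\<in>Fpn p m. \<Sum>j<p. T i e j)"
        by (subst sum.swap) (intro sum.cong refl, rule sum.swap)
      also have "\<dots> = (\<Sum>i<p. \<Sum>e\<in>Fpn p m. C' (e @ [i]) * (int a ^ i * (\<Prod>i<m. x' i ^ (e ! i))))"
        unfolding C'_def T_def last_snoc butlast_snoc sum_distrib_right by (simp only: mult.assoc)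
      also have "\<dots> = (\<Sum>(i, e)\<in>{..<p} \<times> Fpn p m. C' (e @ [i]) * (int a ^ i * (\<Prod>i<m. x' i ^ (e ! i))))"
        by (simp add: sum.cartesian_product)
      also have "\<dots> = (\<Sum>e\<in>Fpn p (Suc m). C' e * (\<Prod>i<Suc m. x i ^ (e ! i)))"
      proof (rule sum.reindex_bij_witness[where j = "\<lambda>(i, e). e @ [i]" and i = "\<lambda>e. (last e, butlast e)"], goal_cases)
        case (5 b)
        obtain i e where b: "b = (i, e)" "length e = m" "\<forall>z\<in>set e. z < p" "i < p" using 5 by (auto simp: Fpn_def)
        have "(\<Prod>l<m. x l ^ ((e @ [i]) ! l)) = (\<Prod>l<m. x' l ^ (e ! l))"
          by (intro prod.cong) (auto simp: nth_append b x'_def)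
        then show ?case by (simp add: b a nth_append mult_ac)
      qed (auto simp: Fpn_def length_Suc_conv_rev in_set_butlastD)
      also have "\<dots> = (\<Sum>e\<in>Fpn p (Suc m). if sum_list e < k then C' e * (\<Prod>i<Suc m. x i ^ (e ! i)) else 0)"
      proof (intro sum.cong refl)
        fix e' assume "e' \<in> Fpn p (Suc m)"
        then obtain e i where e': "e' = e @ [i]" by (auto simp: Fpn_def length_Suc_conv_rev)
        have "C' e' = 0" if "\<not> sum_list e' < k"
          unfolding C'_def
        proof (intro sum.neutral ballI)
          fix j assume "j \<in> {..<p}"
          then show "s j (last e') * (if sum_list (butlast e') < k - j then C j (butlast e') else 0) = 0"
            using s0[of j i] that by (auto simp: e')
        qed
        then show "C' e' * (\<Prod>i<Suc m. x i ^ (e' ! i)) = (if sum_list e' < k then C' e' * (\<Prod>i<Suc m. x i ^ (e' ! i)) else 0)"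
          by auto
      qed
      also have "\<dots> = poly_fun (Suc m) k C' x"
        unfolding poly_fun_def low_exps_def by (simp only: sum.inter_filter finite_Fpn)
      finally show ?thesis .
    qed
    ultimately show "int p dvd g x - poly_fun (Suc m) k C' x"
      unfolding g by (simp add: sum_subtractf)
  qed
qed

end

section \<open>Random affine restrictions and interpolation\<close>

lemma avg_lists_all:
  assumes "finite Y" "Y \<noteq> {}"
  shows "avg (lists_of Y m) (\<lambda>ys. of_bool (\<forall>y\<in>set ys. Q y)) = avg Y (\<lambda>y. of_bool (Q y)) ^ m"
proof (induction m)
  case (Suc m)
  have "avg (lists_of Y (Suc m)) (\<lambda>ys. of_bool (\<forall>y\<in>set ys. Q y))
     = avg Y (\<lambda>y. avg (lists_of Y m) (\<lambda>ys. of_bool (Q y) * of_bool (\<forall>y\<in>set ys. Q y)))"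
    unfolding avg_lists_Suc by (intro avg_cong) auto
  also have "\<dots> = avg Y (\<lambda>y. avg Y (\<lambda>y. of_bool (Q y)) ^ m * of_bool (Q y))"
    by (rule avg_cong) (simp only: avg_cmult Suc, simp only: mult.commute)
  finally show ?case unfolding avg_cmult by simp
qed simp

lemma avg_lists_take:
  assumes "finite Y" "Y \<noteq> {}" "k \<le> r"
  shows "avg (lists_of Y r) (\<lambda>ys. \<phi> (take k ys)) = avg (lists_of Y k) \<phi>"
  using assms(3)
proof (induction k arbitrary: r \<phi>)
  case 0
  then show ?case using assms by (simp add: lists_of_eq_empty_iff)
next
  case (Suc k)
  then obtain r' where "r = Suc r'" "k \<le> r'" by (metis Suc_le_D Suc_le_mono)
  then show ?case using Suc.IH[of r' "\<lambda>ys. \<phi> (_ # ys)"] by (simp add: avg_lists_Suc)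
qed

text \<open>The erased set may depend on all earlier points, but the next point is independent of
  them. So each of the \<open>s\<close> points falls into a set of size at most \<open>K\<close>
  with probability at most \<open>K * \<kappa>\<close>.\<close>

lemma adaptive_hit_bound:
  assumes Y: "finite Y" "Y \<noteq> {}"
    and hit: "\<And>z. avg Y (\<lambda>y. of_bool (\<psi> y = z)) \<le> \<kappa>"
    and Er: "\<And>xs. finite (Er xs) \<and> card (Er xs) \<le> K"
  shows "avg (lists_of Y s) (\<lambda>ys. of_bool (\<exists>i<s. \<psi> (ys ! i) \<in> Er (map \<psi> (take i ys)))) \<le> s * K * \<kappa>"
  using Er
proof (induction s arbitrary: Er)
  case (Suc s)
  have \<kappa>: "0 \<le> \<kappa>" using hit[of undefined] avg_nonneg[of Y "\<lambda>y. of_bool (\<psi> y = undefined)"] by simp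
  have "avg Y (\<lambda>y. of_bool (\<psi> y \<in> Er [])) \<le> avg Y (\<lambda>y. \<Sum>z\<in>Er []. of_bool (\<psi> y = z))"
    using Suc.prems[of "[]"] by (intro avg_mono) (simp add: of_bool_def)
  also have "\<dots> = (\<Sum>z\<in>Er []. avg Y (\<lambda>y. of_bool (\<psi> y = z)))" by (rule avg_sum)
  also have "\<dots> \<le> (\<Sum>z\<in>Er []. \<kappa>)" by (intro sum_mono hit)
  also have "\<dots> \<le> K * \<kappa>" using Suc.prems[of "[]"] \<kappa> by (simp add: mult_right_mono)
  finally have first: "avg Y (\<lambda>y. of_bool (\<psi> y \<in> Er [])) \<le> K * \<kappa>" .
  have rest: "avg (lists_of Y s) (\<lambda>ys. of_bool (\<exists>i<s. \<psi> (ys ! i) \<in> Er (\<psi> y # map \<psi> (take i ys)))) \<le> s * K * \<kappa>" for y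
    using Suc.IH[of "\<lambda>xs. Er (\<psi> y # xs)"] Suc.prems by simp
  have "avg (lists_of Y (Suc s)) (\<lambda>ys. of_bool (\<exists>i<Suc s. \<psi> (ys ! i) \<in> Er (map \<psi> (take i ys))))
     \<le> avg Y (\<lambda>y. avg (lists_of Y s) (\<lambda>ys. of_bool (\<psi> y \<in> Er [])) +
         avg (lists_of Y s) (\<lambda>ys. of_bool (\<exists>i<s. \<psi> (ys ! i) \<in> Er (\<psi> y # map \<psi> (take i ys)))))"
    unfolding avg_lists_Suc
  proof (intro avg_mono avg_of_bool_disj)
    fix y ys assume "\<exists>i<Suc s. \<psi> ((y # ys) ! i) \<in> Er (map \<psi> (take i (y # ys)))"
    then obtain i where i: "i < Suc s" "\<psi> ((y # ys) ! i) \<in> Er (map \<psi> (take i (y # ys)))" by blast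
    then show "\<psi> y \<in> Er [] \<or> (\<exists>i<s. \<psi> (ys ! i) \<in> Er (\<psi> y # map \<psi> (take i ys)))"
      by (cases i) auto
  qed
  also have "\<dots> \<le> avg Y (\<lambda>y. of_bool (\<psi> y \<in> Er []) + s * K * \<kappa>)"
    using rest Y by (intro avg_mono add_mono) (auto simp: lists_of_eq_empty_iff)
  also have "\<dots> \<le> K * \<kappa> + s * K * \<kappa>"
    using first Y by (simp add: avg_add)
  finally show ?case by (simp add: algebra_simps)
qed (simp add: Y)

section \<open>Linear maps given by their list of columns\<close>

definition lin :: "(nat \<Rightarrow> int) \<Rightarrow> (nat \<Rightarrow> int) list \<Rightarrow> nat \<Rightarrow> int" where
  "lin y cs = (\<lambda>i. \<Sum>l<length cs. y l * (cs ! l) i)"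

definition unit_vec :: "nat \<Rightarrow> nat \<Rightarrow> int" where
  "unit_vec l = (\<lambda>i. if i = l then 1 else 0)"

lemma lin_add: "lin (x + y) cs = lin x cs + lin y cs"
  by (simp add: lin_def fun_eq_iff algebra_simps sum.distrib)

lemma lin_Cons: "lin y (c # cs) = (\<lambda>i. y 0 * c i) + lin (\<lambda>l. y (Suc l)) cs"
  unfolding lin_def fun_eq_iff length_Cons sum.lessThan_Suc_shift by simp

lemma lin_unit_vec: "l < length cs \<Longrightarrow> lin (unit_vec l) cs = cs ! l"
proof -
  assume l: "l < length cs"
  have "(\<Sum>j<length cs. unit_vec l j * (cs ! j) i) = (\<Sum>j<length cs. if j = l then (cs ! j) i else 0)" for i
    by (intro sum.cong) (auto simp: unit_vec_def)
  then show ?thesis using l by (simp add: lin_def fun_eq_iff)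
qed

lemma deriv_list_affine:
  "deriv_list hs (\<lambda>y. f (b + lin y cs)) a = deriv_list (map (\<lambda>h. lin h cs) hs) f (b + lin a cs)"
  by (induction hs arbitrary: a) (auto simp: lin_add add.assoc)

context prime_mod begin

lemma vred_eq_iff: "vred p n v = vred p n w \<longleftrightarrow> (\<forall>i<n. int p dvd v i - w i)"
  by (auto simp: vred_def fun_eq_iff mod_eq_dvd_iff)

lemma to_list_eq_iff: "to_list p n v = to_list p n w \<longleftrightarrow> vred p n v = vred p n w"
proof -
  have "nat (v i mod int p) = nat (w i mod int p) \<longleftrightarrow> v i mod int p = w i mod int p" for i
    by (simp add: eq_nat_nat_iff)
  then show ?thesis by (auto simp: to_list_def vred_def fun_eq_iff)
qed

lemma vred_lin_vred:
  assumes "length cs = r" shows "vred p n (b + lin (vred p r y) cs) = vred p n (b + lin y cs)"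
  unfolding vred_eq_iff
proof (intro allI impI)
  fix i
  have "(b + lin (vred p r y) cs) i - (b + lin y cs) i = (\<Sum>l<r. (y l mod int p - y l) * (cs ! l) i)"
    using assms by (simp add: lin_def vred_def sum_subtractf left_diff_distrib)
  also have "int p dvd \<dots>"
    by (intro dvd_sum dvd_mult2) (simp flip: mod_eq_dvd_iff)
  finally show "int p dvd (b + lin (vred p r y) cs) i - (b + lin y cs) i" .
qed

lemma periodic_affine:
  assumes "V.periodic n f" "length cs = r"
  shows "V.periodic r (\<lambda>y. f (b + lin y cs))"
  using assms vred_lin_vred[OF assms(2)] unfolding V.periodic_def by metis

lemma deriv_vanish_affine:
  assumes "V.deriv_vanish n q k g" "length cs = r"
  shows "V.deriv_vanish r q k (\<lambda>y. g (b + lin y cs))"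
  using assms unfolding V.deriv_vanish_def
  using periodic_affine[of n g cs r b] by (simp add: deriv_list_affine)

lemma deg_le_of_deriv_vanish:
  assumes "V.deriv_vanish n (int p) (Suc d) g"
  defines "f \<equiv> \<lambda>xs. nat (g (of_list xs) mod int p)"
  shows "is_fn p n f" "deg_le p n d f"
proof -
  show "is_fn p n f" by (simp add: is_fn_def f_def nat_less_iff)
  obtain C where C: "\<And>x. x \<in> vecs p n \<Longrightarrow> int p dvd g x - poly_fun n (Suc d) C x"
    using poly_representation[of "Suc d" g n] assms by (auto simp: V.deriv_vanish_def)
  show "deg_le p n d f"
    unfolding deg_le_def
  proof (intro exI[of _ "\<lambda>e. nat (C e mod int p)"] ballI)
    fix x assume x: "x \<in> Fpn p n"
    then have lx: "length x = n" by (simp add: Fpn_def)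
    have xv: "of_list x \<in> vecs p n" using x by (auto simp: Fpn_def of_list_def vecs_def)
    have "int (\<Sum>e\<in>Fpn p n. if sum_list e \<le> d then nat (C e mod int p) * mono_eval x e else 0)
       = (\<Sum>e\<in>low_exps n (Suc d). (C e mod int p) * (\<Prod>i<n. of_list x i ^ (e ! i)))"
      unfolding low_exps_def by (simp add: sum.inter_filter mono_eval_def lx of_list_def less_Suc_eq_le
          if_distrib[of int] cong: if_cong)
    moreover have "\<dots> mod int p = poly_fun n (Suc d) C (of_list x) mod int p"
      unfolding poly_fun_def by (subst (1 2) mod_sum_eq[symmetric]) (simp add: mod_mult_left_eq)
    moreover have "\<dots> = g (of_list x) mod int p"
      using C[OF xv] by (simp add: mod_eq_dvd_iff dvd_diff_commute)
    ultimately have "int (f x) = int ((\<Sum>e\<in>Fpn p n. if sum_list e \<le> d then nat (C e mod int p) * mono_eval x e else 0) mod p)"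
      by (simp add: f_def zmod_int)
    then show "f x = (\<Sum>e\<in>Fpn p n. if sum_list e \<le> d then nat (C e mod int p) * mono_eval x e else 0) mod p"
      by simp
  qed
qed

lemma far_dist_mod:
  assumes "is_fn p n f" "far_from_deg p n d \<delta> f" "V.deriv_vanish n (int p) (Suc d) g"
  shows "\<delta> \<le> V.dist_mod n (int p) (lift p n f) g"
proof -
  let ?f' = "\<lambda>xs. nat (g (of_list xs) mod int p)"
  have "\<delta> \<le> rel_dist p n f ?f'"
    using assms(2) deg_le_of_deriv_vanish[OF assms(3)] by (auto simp: far_from_deg_def)
  also have "\<dots> = avg (Fpn p n) (\<lambda>x. of_bool (f x \<noteq> ?f' x))"
    by (simp add: rel_dist_def avg_def Int_def)
  also have "\<dots> = avg (vecs p n) (\<lambda>v. of_bool (f (to_list p n v) \<noteq> ?f' (to_list p n v)))"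
    by (rule avg_reindex[OF bij_to_list])
  also have "\<dots> \<le> avg (vecs p n) (\<lambda>v. of_bool (\<not> int p dvd lift p n f v - g v))"
  proof (rule avg_mono)
    fix v assume v: "v \<in> vecs p n"
    have ov: "of_list (to_list p n v) = v"
      using v by (auto simp: vecs_def of_list_def to_list_def fun_eq_iff)
    have "f (to_list p n v) = ?f' (to_list p n v)" if "int p dvd lift p n f v - g v"
    proof -
      have "int (f (to_list p n v)) mod int p = g v mod int p"
        using that by (simp add: lift_def mod_eq_dvd_iff)
      moreover have "f (to_list p n v) < p" using assms(1) by (simp add: is_fn_def)
      ultimately show ?thesis by (simp add: ov flip: zmod_int)
    qed
    then show "of_bool (f (to_list p n v) \<noteq> ?f' (to_list p n v)) \<le> (of_bool (\<not> int p dvd lift p n f v - g v) :: real)"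
      by auto
  qed
  finally show ?thesis by (simp add: V.dist_mod_def)
qed

text \<open>The threshold below which the hypothesis \<open>small\<close> of
  \<open>self_correction\<close> holds.\<close>

definition \<tau> :: "nat \<Rightarrow> real" where
  "\<tau> k = 1 / (2 ^ k * (real k + 2 ^ k))"

lemma \<tau>_pos: "\<tau> k > 0"
  unfolding \<tau>_def by (intro divide_pos_pos mult_pos_pos add_nonneg_pos) auto

text \<open>Either the rejection probability is at least the constant \<open>\<tau> (Suc d)\<close>,
  or self-correction yields a degree \<open>d\<close> function within twice that probability, so it
  is at least \<open>\<delta> / 2\<close>. Both dominate
  \<open>\<tau> (Suc d) * \<delta>\<close>.\<close>

lemma far_reject:
  assumes "is_fn p n f" "far_from_deg p n d \<delta> f" "0 < \<delta>" "\<delta> \<le> 1"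
  shows "\<tau> (Suc d) * \<delta> \<le> V.reject_prob_test n (int p) (Suc d) (lift p n f)"
proof (cases "V.reject_prob_test n (int p) (Suc d) (lift p n f) < \<tau> (Suc d)")
  case True
  then have "2 ^ Suc d * (real (Suc d) + 2 ^ Suc d) * V.reject_prob_test n (int p) (Suc d) (lift p n f) < 1"
    by (simp add: \<tau>_def pos_less_divide_eq mult_pos_pos add_nonneg_pos mult.commute)
  from V.self_correction[OF lift_periodic _ this] obtain g
    where "V.deriv_vanish n (int p) (Suc d) g"
      "V.dist_mod n (int p) (lift p n f) g \<le> 2 * V.reject_prob_test n (int p) (Suc d) (lift p n f)" by auto
  with far_dist_mod[OF assms(1,2)] have "\<delta> / 2 \<le> V.reject_prob_test n (int p) (Suc d) (lift p n f)" by fastforce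
  moreover have "\<tau> (Suc d) \<le> 1 / 2"
  proof -
    have "(2::real) ^ 1 \<le> 2 ^ Suc d" by (intro power_increasing) auto
    moreover have "1 \<le> real (Suc d) + 2 ^ Suc d" by simp
    ultimately have "2 * 1 \<le> 2 ^ Suc d * (real (Suc d) + 2 ^ Suc d)"
      by (intro mult_mono) auto
    then have "2 \<le> 2 ^ Suc d * (real (Suc d) + 2 ^ Suc d)" by simp
    then show ?thesis unfolding \<tau>_def by (intro divide_left_mono) auto
  qed
  then have "\<tau> (Suc d) * \<delta> \<le> 1 / 2 * \<delta>" using assms by (intro mult_right_mono) auto
  ultimately show ?thesis by simp
next
  case False
  moreover have "\<tau> (Suc d) * \<delta> \<le> \<tau> (Suc d) * 1" using assms \<tau>_pos[of "Suc d"] by (intro mult_left_mono) auto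
  ultimately show ?thesis by simp
qed

section \<open>Interpolation from random points\<close>

abbreviation vanishing :: "nat \<Rightarrow> nat \<Rightarrow> ((nat \<Rightarrow> int) \<Rightarrow> int) \<Rightarrow> bool" where
  "vanishing r d g \<equiv> V.deriv_vanish r (int p) (Suc d) g"

lemma finite_low_exps [simp]: "finite (low_exps m k)"
  by (simp add: low_exps_def)

text \<open>Union bound over polynomials with reduced coefficients, at most \<open>p\<close> to the
  number of monomials. Each one that represents a nonzero function vanishes at a random point with
  probability at most \<open>1 - 1 / 2 ^ d\<close>.\<close>

lemma noninterpolating_bound:
  "avg (lists_of (vecs p r) m) (\<lambda>ys. of_bool (\<exists>g. vanishing r d g \<and> (\<exists>x. \<not> int p dvd g x) \<and> (\<forall>y\<in>set ys. int p dvd g y)))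
    \<le> p ^ card (low_exps r (Suc d)) * (1 - 1 / 2 ^ d) ^ m" (is "avg _ ?bad \<le> _")
proof -
  define Fam where "Fam = PiE (low_exps r (Suc d)) (\<lambda>_. {0..<int p})"
  define \<G> where "\<G> = {C \<in> Fam. \<exists>g. vanishing r d g \<and> (\<exists>x. \<not> int p dvd g x) \<and>
      (\<forall>x\<in>vecs p r. int p dvd g x - poly_fun r (Suc d) C x)}"
  have fin: "finite Fam" unfolding Fam_def by (intro finite_PiE) auto
  then have fin': "finite \<G>" by (simp add: \<G>_def)
  have card: "card \<G> \<le> p ^ card (low_exps r (Suc d))"
  proof -
    have "card \<G> \<le> card Fam" using fin by (intro card_mono) (auto simp: \<G>_def)
    also have "\<dots> = p ^ card (low_exps r (Suc d))" by (simp add: Fam_def card_PiE)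
    finally show ?thesis .
  qed
  have "?bad ys \<le> (\<Sum>C\<in>\<G>. of_bool (\<forall>y\<in>set ys. int p dvd poly_fun r (Suc d) C y))"
    if ys: "ys \<in> lists_of (vecs p r) m" for ys
  proof (cases "\<exists>g. vanishing r d g \<and> (\<exists>x. \<not> int p dvd g x) \<and> (\<forall>y\<in>set ys. int p dvd g y)")
    case True
    then obtain g where g: "vanishing r d g" "\<exists>x. \<not> int p dvd g x" "\<forall>y\<in>set ys. int p dvd g y" by blast
    obtain C where C: "\<And>x. x \<in> vecs p r \<Longrightarrow> int p dvd g x - poly_fun r (Suc d) C x"
      using poly_representation[of "Suc d" g r] g(1) by (auto simp: V.deriv_vanish_def)
    define C' where "C' = restrict (\<lambda>e. C e mod int p) (low_exps r (Suc d))"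
    have C': "int p dvd g x - poly_fun r (Suc d) C' x" if "x \<in> vecs p r" for x
    proof -
      have "poly_fun r (Suc d) C' x mod int p = poly_fun r (Suc d) C x mod int p"
        unfolding poly_fun_def by (subst (1 2) mod_sum_eq[symmetric]) (simp add: C'_def mod_mult_left_eq)
      then show ?thesis using C[OF that] by (simp flip: mod_eq_dvd_iff)
    qed
    have "C' \<in> \<G>" unfolding \<G>_def Fam_def using g C' by (auto simp: C'_def)
    moreover have "\<forall>y\<in>set ys. int p dvd poly_fun r (Suc d) C' y"
    proof
      fix y assume y: "y \<in> set ys"
      then have "y \<in> vecs p r" using ys by (auto simp: lists_of_def)
      from C'[OF this] g(3) y show "int p dvd poly_fun r (Suc d) C' y"
        by (simp add: dvd_diff_right_iff)
    qed
    ultimately show ?thesis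
      using member_le_sum[of C' \<G> "\<lambda>C. of_bool (\<forall>y\<in>set ys. int p dvd poly_fun r (Suc d) C y) :: real"] fin' by auto
  qed (auto intro: sum_nonneg)
  then have "avg (lists_of (vecs p r) m) ?bad \<le>
      avg (lists_of (vecs p r) m) (\<lambda>ys. \<Sum>C\<in>\<G>. of_bool (\<forall>y\<in>set ys. int p dvd poly_fun r (Suc d) C y))"
    by (rule avg_mono)
  also have "\<dots> = (\<Sum>C\<in>\<G>. avg (vecs p r) (\<lambda>y. of_bool (int p dvd poly_fun r (Suc d) C y)) ^ m)"
    unfolding avg_sum by (subst avg_lists_all) auto
  also have "\<dots> \<le> (\<Sum>C\<in>\<G>. (1 - 1 / 2 ^ d) ^ m)"
  proof (intro sum_mono power_mono)
    fix C assume "C \<in> \<G>"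
    then obtain g where g: "vanishing r d g" "\<exists>x. \<not> int p dvd g x"
      "\<And>x. x \<in> vecs p r \<Longrightarrow> int p dvd g x - poly_fun r (Suc d) C x" by (auto simp: \<G>_def)
    have "avg (vecs p r) (\<lambda>y. of_bool (int p dvd poly_fun r (Suc d) C y)) = avg (vecs p r) (\<lambda>y. 1 - of_bool (\<not> int p dvd g y))"
    proof (rule avg_cong)
      fix y assume "y \<in> vecs p r"
      from g(3)[OF this] have "int p dvd poly_fun r (Suc d) C y \<longleftrightarrow> int p dvd g y"
        unfolding mod_eq_dvd_iff[symmetric] by (simp add: dvd_eq_mod_eq_0)
      then show "of_bool (int p dvd poly_fun r (Suc d) C y) = 1 - (of_bool (\<not> int p dvd g y) :: real)" by simp
    qed
    also have "\<dots> = 1 - avg (vecs p r) (\<lambda>y. of_bool (\<not> int p dvd g y))" by (simp add: avg_diff)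
    also have "\<dots> \<le> 1 - 1 / 2 ^ d" using V.nonzero_density[OF g(1,2)] by simp
    finally show "avg (vecs p r) (\<lambda>y. of_bool (int p dvd poly_fun r (Suc d) C y)) \<le> 1 - 1 / 2 ^ d" .
  qed (auto intro: avg_nonneg)
  also have "\<dots> \<le> p ^ card (low_exps r (Suc d)) * (1 - 1 / 2 ^ d) ^ m"
  proof -
    have "real (card \<G>) \<le> real (p ^ card (low_exps r (Suc d)))" using card by (rule of_nat_mono)
    moreover have "0 \<le> (1 - 1 / 2 ^ d :: real) ^ m" by simp
    ultimately show ?thesis by (simp add: mult_right_mono)
  qed
  finally show ?thesis by simp
qed

definition fits :: "nat \<Rightarrow> nat \<Rightarrow> ((nat \<Rightarrow> int) \<Rightarrow> int) \<Rightarrow> (nat \<Rightarrow> int) list \<Rightarrow> bool" where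
  "fits r d F ys \<longleftrightarrow> (\<exists>g. vanishing r d g \<and> (\<forall>y\<in>set ys. int p dvd F y - g y))"

definition misfit_prob :: "nat \<Rightarrow> nat \<Rightarrow> nat \<Rightarrow> ((nat \<Rightarrow> int) \<Rightarrow> int) \<Rightarrow> real" where
  "misfit_prob r d m F = avg (lists_of (vecs p r) (Suc m)) (\<lambda>ys. of_bool (\<not> fits r d F ys))"

definition enough :: "nat \<Rightarrow> nat \<Rightarrow> nat \<Rightarrow> bool" where
  "enough r d m \<longleftrightarrow> p ^ card (low_exps r (Suc d)) * (1 - 1 / 2 ^ d) ^ m \<le> (1 / 2 :: real)"

text \<open>With probability at least one half the first \<open>m\<close> points determine a fitting
  function uniquely. If one exists, the extra point exposes its disagreement with \<open>F\<close>
  with probability at least \<open>\<eta>\<close>; if none exists, misfit is already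
  certain.\<close>

lemma misfit_prob_ge:
  assumes m: "enough r d m"
    and far: "\<And>g. vanishing r d g \<Longrightarrow> \<eta> \<le> V.dist_mod r (int p) F g" and \<eta>: "0 \<le> \<eta>" "\<eta> \<le> 1"
  shows "\<eta> / 2 \<le> misfit_prob r d m F"
proof -
  define bad where "bad ys \<longleftrightarrow> (\<exists>g. vanishing r d g \<and> (\<exists>x. \<not> int p dvd g x) \<and> (\<forall>y\<in>set ys. int p dvd g y))" for ys
  have "avg (lists_of (vecs p r) m) (\<lambda>ys. of_bool (bad ys)) \<le> 1 / 2"
    using noninterpolating_bound[of r m d] m unfolding enough_def bad_def by linarith
  moreover have "avg (lists_of (vecs p r) m) (\<lambda>ys. \<eta> * (1 - of_bool (bad ys)))
      = \<eta> * (1 - avg (lists_of (vecs p r) m) (\<lambda>ys. of_bool (bad ys)))"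
    unfolding avg_cmult avg_diff by simp
  ultimately have "\<eta> / 2 \<le> avg (lists_of (vecs p r) m) (\<lambda>ys. \<eta> * (1 - of_bool (bad ys)))"
    using mult_left_mono[of "1/2" "1 - avg (lists_of (vecs p r) m) (\<lambda>ys. of_bool (bad ys))" \<eta>] \<eta> by simp
  also have "\<dots> \<le> avg (lists_of (vecs p r) m) (\<lambda>ys. avg (vecs p r) (\<lambda>y. of_bool (\<not> fits r d F (y # ys))))"
  proof (rule avg_mono)
    fix ys
    show "\<eta> * (1 - of_bool (bad ys)) \<le> avg (vecs p r) (\<lambda>y. of_bool (\<not> fits r d F (y # ys)))"
    proof (cases "bad ys")
      case True
      then show ?thesis by (auto intro: avg_nonneg)
    next
      case good: False
      show ?thesis
      proof (cases "fits r d F ys")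
        case True
        then obtain g where g: "vanishing r d g" "\<forall>y\<in>set ys. int p dvd F y - g y" by (auto simp: fits_def)
        have "\<not> fits r d F (y # ys)" if "\<not> int p dvd F y - g y" for y
        proof
          assume "fits r d F (y # ys)"
          then obtain g' where g': "vanishing r d g'" "\<forall>z\<in>set (y # ys). int p dvd F z - g' z" by (auto simp: fits_def)
          have "vanishing r d (\<lambda>x. g x - g' x)"
            using g(1) g'(1) by (simp add: V.deriv_vanish_def V.periodic_def deriv_list_diff)
          moreover have "int p dvd g z - g' z" if "z \<in> set ys" for z
          proof -
            have "int p dvd (F z - g' z) - (F z - g z)" using that g(2) g'(2) by (intro dvd_diff[of _ "_ - _" "_ - _"]) auto
            then show ?thesis by simp
          qed
          ultimately have "int p dvd g y - g' y" using good unfolding bad_def by blast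
          moreover have "int p dvd F y - g' y" using g' by simp
          ultimately have "int p dvd (F y - g' y) - (g y - g' y)" by (intro dvd_diff[of _ "_ - _" "_ - _"])
          with that show False by simp
        qed
        then have "V.dist_mod r (int p) F g \<le> avg (vecs p r) (\<lambda>y. of_bool (\<not> fits r d F (y # ys)))"
          unfolding V.dist_mod_def by (intro avg_mono) auto
        with far[OF g(1)] good show ?thesis by simp
      next
        case False
        then have "\<not> fits r d F (y # ys)" for y by (auto simp: fits_def)
        then show ?thesis using \<eta> good by simp
      qed
    qed
  qed
  also have "\<dots> = misfit_prob r d m F"
    unfolding misfit_prob_def avg_lists_Suc by (rule avg_swap)
  finally show ?thesis .
qed

text \<open>If a vanishing \<open>g\<close> agrees with \<open>F\<close> on a whole cube, the
  derivative of \<open>F\<close> there is zero. Hence every such \<open>g\<close> is at distance at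
  least the nonzero density of the derivative divided by \<open>2 ^ Suc d\<close>; interpolation
  loses another factor 2.\<close>

lemma misfit_prob_ge_deriv:
  assumes m: "enough r d m" and F: "V.periodic r F" and hs: "length hs = Suc d"
  shows "avg (vecs p r) (\<lambda>a. of_bool (\<not> int p dvd deriv_list hs F a)) \<le> 2 ^ (d + 2) * misfit_prob r d m F"
proof -
  let ?\<epsilon> = "avg (vecs p r) (\<lambda>a. of_bool (\<not> int p dvd deriv_list hs F a)) :: real"
  have "?\<epsilon> / 2 ^ Suc d \<le> V.dist_mod r (int p) F g" if g: "vanishing r d g" for g
  proof -
    have per: "V.periodic r (\<lambda>z. \<not> int p dvd F z - g z)"
      using F g by (simp add: V.deriv_vanish_def V.periodic_def)
    have "?\<epsilon> \<le> avg (vecs p r) (\<lambda>a. of_bool (\<exists>z\<in>cube hs a. \<not> int p dvd F z - g z))"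
    proof (rule avg_mono)
      fix a
      have "int p dvd deriv_list hs F a" if "\<forall>z\<in>cube hs a. int p dvd F z - g z"
      proof -
        have "int p dvd deriv_list hs F a - deriv_list hs g a" by (rule deriv_list_cong[OF that])
        moreover have "int p dvd deriv_list hs g a" using g hs by (simp add: V.deriv_vanish_def)
        ultimately show ?thesis
          using dvd_add[of "int p" "deriv_list hs F a - deriv_list hs g a" "deriv_list hs g a"] by simp
      qed
      then show "of_bool (\<not> int p dvd deriv_list hs F a) \<le> (of_bool (\<exists>z\<in>cube hs a. \<not> int p dvd F z - g z) :: real)"
        by auto
    qed
    also have "\<dots> \<le> 2 ^ Suc d * V.dist_mod r (int p) F g"
      using V.cube_hits[OF per, of hs] hs by (simp add: V.dist_mod_def)
    finally show ?thesis by (simp add: divide_le_eq mult.commute)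
  qed
  moreover have "0 \<le> ?\<epsilon>" by (intro avg_nonneg) simp
  moreover have "?\<epsilon> / 2 ^ Suc d \<le> 1"
    using avg_of_bool_le_1[of "vecs p r" "\<lambda>a. \<not> int p dvd deriv_list hs F a"] one_le_power[of "2::real" "Suc d"]
    by (simp add: divide_le_eq)
  ultimately have "?\<epsilon> / 2 ^ Suc d / 2 \<le> misfit_prob r d m F"
    by (intro misfit_prob_ge[OF m]) auto
  then show ?thesis by (simp add: field_simps)
qed

text \<open>The differences of the restriction along the first \<open>d + 1\<close> unit vectors are
  the differences of \<open>f\<close> along the first \<open>d + 1\<close> columns. The base point
  \<open>b + lin a cs\<close> is uniform for every fixed \<open>a\<close> and \<open>cs\<close>, so
  this is exactly the derivative test.\<close>

lemma misfit_random_affine: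
  assumes m: "enough r d m" and f: "V.periodic n f" and r: "Suc d \<le> r"
  shows "V.reject_prob_test n (int p) (Suc d) f \<le> 2 ^ (d + 2) *
     avg (vecs p n) (\<lambda>b. avg (lists_of (vecs p n) r) (\<lambda>cs. misfit_prob r d m (\<lambda>y. f (b + lin y cs))))"
proof -
  let ?X = "vecs p n" and ?L = "lists_of (vecs p n) r"
  define \<phi> where "\<phi> cs b = (of_bool (\<not> int p dvd deriv_list (take (Suc d) cs) f b) :: real)" for cs b
  have "V.reject_prob_test n (int p) (Suc d) f = avg ?X (\<lambda>b. avg ?L (\<lambda>cs. \<phi> cs b))"
    unfolding V.reject_prob_test_def \<phi>_def
    by (rule avg_cong, rule avg_lists_take[OF _ _ r, symmetric]) auto
  also have "\<dots> = avg ?L (\<lambda>cs. avg (vecs p r) (\<lambda>a. avg ?X (\<phi> cs)))"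
    using avg_swap[of ?X ?L "\<lambda>b cs. \<phi> cs b"] by simp
  also have "\<dots> = avg ?L (\<lambda>cs. avg (vecs p r) (\<lambda>a. avg ?X (\<lambda>b. \<phi> cs (b + lin a cs))))"
    unfolding \<phi>_def by (rule avg_cong, rule avg_cong, rule V.avg_shift[OF V.periodic_pred[OF f], symmetric])
  also have "\<dots> = avg ?X (\<lambda>b. avg ?L (\<lambda>cs. avg (vecs p r) (\<lambda>a. \<phi> cs (b + lin a cs))))"
    by (rule avg_rot[symmetric])
  also have "\<dots> \<le> avg ?X (\<lambda>b. avg ?L (\<lambda>cs. 2 ^ (d + 2) * misfit_prob r d m (\<lambda>y. f (b + lin y cs))))"
  proof (intro avg_mono)
    fix b cs assume "cs \<in> ?L"
    then have len: "length cs = r" by (simp add: lists_of_def)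
    let ?us = "map unit_vec [0..<Suc d]"
    have us: "map (\<lambda>h. lin h cs) ?us = take (Suc d) cs"
      using r len by (intro nth_equalityI) (auto simp: lin_unit_vec simp del: upt_Suc)
    have "avg (vecs p r) (\<lambda>a. \<phi> cs (b + lin a cs)) =
        avg (vecs p r) (\<lambda>a. of_bool (\<not> int p dvd deriv_list ?us (\<lambda>y. f (b + lin y cs)) a))"
      unfolding deriv_list_affine us \<phi>_def ..
    also have "\<dots> \<le> 2 ^ (d + 2) * misfit_prob r d m (\<lambda>y. f (b + lin y cs))"
      by (rule misfit_prob_ge_deriv[OF m periodic_affine[OF f len]]) simp
    finally show "avg (vecs p r) (\<lambda>a. \<phi> cs (b + lin a cs)) \<le> 2 ^ (d + 2) * misfit_prob r d m (\<lambda>y. f (b + lin y cs))" .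
  qed
  finally show ?thesis unfolding avg_cmult .
qed

section \<open>Collision probability of a random affine map\<close>

text \<open>Random columns may be dependent, so the image can be smaller than \<open>p ^ r\<close>.
  The relative size of the kernel measures how predictable a random image point is.\<close>

definition kernel_prob :: "nat \<Rightarrow> nat \<Rightarrow> (nat \<Rightarrow> int) list \<Rightarrow> real" where
  "kernel_prob n r cs = avg (vecs p r) (\<lambda>y. of_bool (vred p n (lin y cs) = vred p n 0))"

text \<open>A nonempty fiber is a coset of the kernel of the linear part.\<close>

lemma fiber_le_kernel:
  assumes len: "length cs = r"
  shows "avg (vecs p r) (\<lambda>y. of_bool (to_list p n (b + lin y cs) = z)) \<le> kernel_prob n r cs"
proof (cases "\<exists>y0. to_list p n (b + lin y0 cs) = z")
  case True
  then obtain y0 where y0: "to_list p n (b + lin y0 cs) = z" by blast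
  have per: "V.periodic r (\<lambda>y. of_bool (vred p n (b + lin y cs) = vred p n (b + lin y0 cs)) :: real)"
    unfolding V.periodic_def by (simp add: vred_lin_vred[OF len])
  have "avg (vecs p r) (\<lambda>y. of_bool (to_list p n (b + lin y cs) = z)) =
     avg (vecs p r) (\<lambda>y. of_bool (vred p n (b + lin y cs) = vred p n (b + lin y0 cs)))"
    unfolding y0[symmetric] to_list_eq_iff ..
  also have "\<dots> = avg (vecs p r) (\<lambda>y. of_bool (vred p n (b + lin (y + y0) cs) = vred p n (b + lin y0 cs)))"
    by (rule V.avg_shift[OF per, symmetric])
  also have "\<dots> = kernel_prob n r cs"
    unfolding kernel_prob_def vred_eq_iff lin_add by simp
  finally show ?thesis by simp
next
  case False
  then show ?thesis by (auto simp: kernel_prob_def intro: avg_nonneg)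
qed

lemma avg_scaled_eq:
  assumes "\<not> int p dvd a"
  shows "avg (vecs p n) (\<lambda>c. of_bool (vred p n ((\<lambda>i. a * c i) + w) = vred p n 0)) \<le> 1 / p ^ n"
proof -
  let ?S = "{c \<in> vecs p n. vred p n ((\<lambda>i. a * c i) + w) = vred p n 0}"
  have "c = c'" if "c \<in> ?S" "c' \<in> ?S" for c c'
  proof -
    have "int p dvd c i - c' i" if "i < n" for i
    proof -
      have "int p dvd a * c i + w i" "int p dvd a * c' i + w i"
        using \<open>c \<in> ?S\<close> \<open>c' \<in> ?S\<close> that by (auto simp: vred_eq_iff)
      then have "int p dvd (a * c i + w i) - (a * c' i + w i)" by (rule dvd_diff)
      then have "int p dvd a * (c i - c' i)" by (simp add: algebra_simps)
      then show ?thesis using assms prime_p by (simp add: prime_dvd_mult_iff)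
    qed
    then have "vred p n c = vred p n c'" by (simp add: vred_eq_iff)
    then show ?thesis using that by (simp add: V.red_id)
  qed
  then have "card ?S \<le> 1" by (intro card_le_Suc0_iff_eq[THEN iffD2, simplified One_nat_def[symmetric]]) auto
  then have "real (card ?S) \<le> 1" by simp
  then show ?thesis
    by (simp add: avg_def Int_def card_vecs divide_right_mono)
qed

text \<open>A coordinate of \<open>y\<close> that is invertible modulo \<open>p\<close> makes the
  combination uniform in the corresponding column, whatever the other columns and the offset
  \<open>w\<close> are.\<close>

lemma avg_lin_zero:
  assumes "l < r" "\<not> int p dvd y l"
  shows "avg (lists_of (vecs p n) r) (\<lambda>cs. of_bool (vred p n (lin y cs + w) = vred p n 0)) \<le> 1 / p ^ n"
  using assms
proof (induction r arbitrary: l y w)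
  case (Suc r)
  let ?X = "vecs p n" and ?L = "lists_of (vecs p n) r"
  have eq: "lin y (c # cs) + w = (\<lambda>i. y 0 * c i) + (lin (\<lambda>l. y (Suc l)) cs + w)" for c cs
    by (simp add: lin_Cons add.assoc)
  show ?case
  proof (cases "int p dvd y 0")
    case True
    then obtain l' where l': "l = Suc l'" using Suc.prems by (cases l) auto
    have "avg (lists_of ?X (Suc r)) (\<lambda>cs. of_bool (vred p n (lin y cs + w) = vred p n 0))
       = avg ?X (\<lambda>c. avg ?L (\<lambda>cs. of_bool (vred p n (lin (\<lambda>l. y (Suc l)) cs + w) = vred p n 0)))"
    proof -
      have "vred p n ((\<lambda>i. y 0 * c i) + v) = vred p n v" for c v
        unfolding vred_eq_iff using True by simp
      then show ?thesis by (simp only: avg_lists_Suc eq)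
    qed
    also have "\<dots> \<le> 1 / p ^ n"
    proof (rule avg_le_const)
      show "avg ?L (\<lambda>cs. of_bool (vred p n (lin (\<lambda>l. y (Suc l)) cs + w) = vred p n 0)) \<le> 1 / p ^ n"
        by (rule Suc.IH[of l']) (use Suc.prems l' in auto)
    qed simp_all
    finally show ?thesis .
  next
    case False
    have "avg (lists_of ?X (Suc r)) (\<lambda>cs. of_bool (vred p n (lin y cs + w) = vred p n 0))
       = avg ?L (\<lambda>cs. avg ?X (\<lambda>c. of_bool (vred p n ((\<lambda>i. y 0 * c i) + (lin (\<lambda>l. y (Suc l)) cs + w)) = vred p n 0)))"
      unfolding avg_lists_Suc eq by (rule avg_swap)
    also have "\<dots> \<le> 1 / p ^ n"
      by (rule avg_le_const[OF _ _ avg_scaled_eq[OF False]]) simp_all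
    finally show ?thesis .
  qed
qed simp

lemma avg_kernel_prob:
  "avg (lists_of (vecs p n) r) (kernel_prob n r) \<le> 1 / p ^ r + 1 / p ^ n"
proof -
  have "avg (lists_of (vecs p n) r) (kernel_prob n r) =
    avg (vecs p r) (\<lambda>y. avg (lists_of (vecs p n) r) (\<lambda>cs. of_bool (vred p n (lin y cs + 0) = vred p n 0)))"
    unfolding kernel_prob_def[abs_def] add_0_right by (rule avg_swap)
  also have "\<dots> \<le> avg (vecs p r) (\<lambda>y. of_bool (y = 0) + 1 / p ^ n)"
  proof (rule avg_mono)
    fix y assume y: "y \<in> vecs p r"
    show "avg (lists_of (vecs p n) r) (\<lambda>cs. of_bool (vred p n (lin y cs + 0) = vred p n 0)) \<le> of_bool (y = 0) + 1 / p ^ n"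
    proof (cases "y = 0")
      case True
      then show ?thesis using avg_of_bool_le_1[of "lists_of (vecs p n) r" "\<lambda>cs. vred p n (lin y cs + 0) = vred p n 0"]
        by (simp add: add_increasing2)
    next
      case False
      then obtain l where l: "y l \<noteq> 0" by (auto simp: fun_eq_iff)
      then have lr: "l < r" using y by (auto simp: vecs_def not_less[symmetric])
      then have "0 < y l" "y l < int p" using y l by (auto simp: vecs_def order_less_le)
      then have "\<not> int p dvd y l" by (rule zdvd_not_zless)
      note lr this
      then show ?thesis using avg_lin_zero[of l r y n 0] False by simp
    qed
  qed
  also have "\<dots> = 1 / p ^ r + 1 / p ^ n"
  proof -
    have "{y \<in> vecs p r. y = 0} = {0}" by (auto simp: vecs_def)
    then have "avg (vecs p r) (\<lambda>y. of_bool (y = 0)) = 1 / p ^ r"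
      by (simp add: avg_def Int_def card_vecs)
    then show ?thesis by (simp add: avg_add)
  qed
  finally show ?thesis .
qed

end

section \<open>Non-adaptive testers against erasures\<close>

lemma cond_pmf_cond_pmf:
  assumes ne: "set_pmf D \<inter> (S \<inter> T) \<noteq> {}"
  shows "cond_pmf (cond_pmf D S) T = cond_pmf D (S \<inter> T)"
proof (rule pmf_eqI)
  fix x
  have neS: "set_pmf D \<inter> S \<noteq> {}" using ne by blast
  have neT: "set_pmf (cond_pmf D S) \<inter> T \<noteq> {}" using ne by (simp add: set_cond_pmf[OF neS] Int_assoc)
  have pos: "measure D S > 0" using neS by (meson disjoint_iff measure_pmf_posI)
  have "measure (cond_pmf D S) T = measure D (S \<inter> T) / measure D S"
    unfolding cond_pmf.rep_eq[OF neS] using pos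
    by (intro measure_uniform_measure) (auto simp: measure_pmf.emeasure_eq_measure)
  then show "pmf (cond_pmf (cond_pmf D S) T) x = pmf (cond_pmf D (S \<inter> T)) x"
    using pos by (simp add: pmf_cond[OF neT] pmf_cond[OF neS] pmf_cond[OF ne])
qed

lemma bind_cond_pmf_fiber:
  "bind_pmf P (\<lambda>x. cond_pmf P {y. F y = F x}) = P"
  by (rule bind_cond_pmf_cancel) (auto intro!: arg_cong[where f = "measure_pmf.prob P"])

section \<open>Replaying a query distribution against an adversary\<close>

fun step :: "(hist \<Rightarrow> nat list set) \<Rightarrow> (nat list \<Rightarrow> nat) \<Rightarrow> nat list set \<times> hist \<Rightarrow> nat list \<Rightarrow> nat list set \<times> hist" where
  "step A f (E, h) x = (let h' = h @ [(x, if x \<in> E then None else Some (f x))] in (E \<union> A h', h'))"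

abbreviation run :: "(hist \<Rightarrow> nat list set) \<Rightarrow> (nat list \<Rightarrow> nat) \<Rightarrow> nat list set \<times> hist \<Rightarrow> nat list list \<Rightarrow> nat list set \<times> hist" where
  "run A f \<equiv> foldl (step A f)"

text \<open>A distribution on query lists of length \<open>Q\<close> becomes a tester by drawing each query
  from its conditional distribution given the earlier ones, which are all in the history.\<close>
definition replay :: "nat list list pmf \<Rightarrow> nat \<Rightarrow> (hist \<Rightarrow> bool) \<Rightarrow> hist \<Rightarrow> action pmf" where
  "replay D Q dec h = (if length h < Q
     then map_pmf (\<lambda>xs. Query (xs ! length h)) (cond_pmf D {xs. take (length h) xs = map fst h})
     else return_pmf (Decide (dec h)))"

text \<open>The adversary and \<open>f\<close> are deterministic, so the answers reveal nothing
  about later queries beyond the points already asked. Conditioning on the prefix of points is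
  therefore enough, and successive conditionings recombine to the original distribution.\<close>

lemma exec_replay:
  assumes len: "\<And>xs. xs \<in> set_pmf D \<Longrightarrow> length xs = Q"
    and "set_pmf D \<inter> {xs. take (length h) xs = map fst h} \<noteq> {}" and "length h + k = Q"
  shows "exec (replay D Q dec) A f E h k =
    map_pmf (\<lambda>xs. dec (snd (run A f (E, h) (drop (length h) xs))))
      (cond_pmf D {xs. take (length h) xs = map fst h})"
  using assms(2,3)
proof (induction k arbitrary: E h)
  case 0
  have "map_pmf (\<lambda>xs. dec (snd (run A f (E, h) (drop (length h) xs))))
      (cond_pmf D {xs. take (length h) xs = map fst h}) = map_pmf (\<lambda>_. dec h) (cond_pmf D {xs. take (length h) xs = map fst h})"
    using 0 len by (intro map_pmf_cong refl) (simp add: set_cond_pmf)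
  then show ?case using 0 by (simp add: replay_def)
next
  case (Suc k)
  let ?l = "length h"
  let ?S = "{xs. take ?l xs = map fst h}"
  let ?P = "cond_pmf D ?S"
  define G where "G xs = dec (snd (run A f (E, h) (drop ?l xs)))" for xs
  define ext where "ext x = h @ [(x, if x \<in> E then None else Some (f x))]" for x
  have "exec (replay D Q dec) A f E h (Suc k) =
      bind_pmf ?P (\<lambda>xs. exec (replay D Q dec) A f (E \<union> A (ext (xs ! ?l))) (ext (xs ! ?l)) k)"
    using Suc.prems by (simp add: replay_def bind_map_pmf Let_def ext_def)
  also have "\<dots> = bind_pmf ?P (\<lambda>xs. map_pmf G (cond_pmf ?P {ys. ys ! ?l = xs ! ?l}))"
  proof (intro bind_pmf_cong refl)
    fix xs assume "xs \<in> set_pmf ?P"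
    then have xs: "xs \<in> set_pmf D" "take ?l xs = map fst h" by (simp_all add: set_cond_pmf[OF Suc.prems(1)])
    let ?x = "xs ! ?l"
    let ?T = "{ys. ys ! ?l = ?x}"
    have ll: "?l < length ys" if "ys \<in> set_pmf D" for ys using len[OF that] Suc.prems by simp
    have set_eq: "ys \<in> {ys. take (length (ext ?x)) ys = map fst (ext ?x)} \<longleftrightarrow> ys \<in> ?S \<inter> ?T"
      if "ys \<in> set_pmf D" for ys
      using ll[OF that] by (auto simp: ext_def take_Suc_conv_app_nth)
    have ne: "set_pmf D \<inter> (?S \<inter> ?T) \<noteq> {}" using xs by auto
    have ne': "set_pmf D \<inter> {ys. take (length (ext ?x)) ys = map fst (ext ?x)} \<noteq> {}"
      using ne set_eq by blast
    \<comment> \<open>The two conditioning sets may differ on lists too short to have the queried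
      position; they agree on the support of \<open>D\<close>.\<close>
    have "measure D {ys. take (length (ext ?x)) ys = map fst (ext ?x)} = measure D (?S \<inter> ?T)"
      using set_eq by (intro measure_pmf.finite_measure_eq_AE) (auto simp: AE_measure_pmf_iff)
    then have cond: "cond_pmf D {ys. take (length (ext ?x)) ys = map fst (ext ?x)} = cond_pmf D (?S \<inter> ?T)"
      using set_eq by (intro pmf_eqI) (auto simp: pmf_cond[OF ne] pmf_cond[OF ne'] set_pmf_iff)
    have "exec (replay D Q dec) A f (E \<union> A (ext ?x)) (ext ?x) k
       = map_pmf (\<lambda>ys. dec (snd (run A f (E \<union> A (ext ?x), ext ?x) (drop (length (ext ?x)) ys))))
           (cond_pmf D {ys. take (length (ext ?x)) ys = map fst (ext ?x)})"
      using Suc.prems by (intro Suc.IH ne') (simp add: ext_def)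
    also have "\<dots> = map_pmf G (cond_pmf D (?S \<inter> ?T))"
      unfolding cond
    proof (intro map_pmf_cong refl)
      fix ys assume "ys \<in> set_pmf (cond_pmf D (?S \<inter> ?T))"
      then have ys: "ys \<in> set_pmf D" "ys ! ?l = ?x" by (simp_all add: set_cond_pmf[OF ne])
      then have "drop ?l ys = ?x # drop (Suc ?l) ys"
        using ll[OF ys(1)] by (metis Cons_nth_drop_Suc)
      then show "dec (snd (run A f (E \<union> A (ext ?x), ext ?x) (drop (length (ext ?x)) ys))) = G ys"
        by (simp add: G_def ext_def Let_def)
    qed
    also have "cond_pmf D (?S \<inter> ?T) = cond_pmf ?P ?T"
      by (rule cond_pmf_cond_pmf[OF ne, symmetric])
    finally show "exec (replay D Q dec) A f (E \<union> A (ext ?x)) (ext ?x) k = map_pmf G (cond_pmf ?P ?T)" .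
  qed
  also have "\<dots> = map_pmf G ?P"
    unfolding map_bind_pmf[symmetric] bind_cond_pmf_fiber ..
  finally show ?case unfolding G_def .
qed

lemma run_erased:
  assumes "valid_adversary t A" "finite E"
  shows "finite (fst (run A f (E, h) xs)) \<and> card (fst (run A f (E, h) xs)) \<le> card E + t * length xs"
  using assms(2)
proof (induction xs arbitrary: E h)
  case (Cons x xs)
  define h' where "h' = h @ [(x, if x \<in> E then None else Some (f x))]"
  have A: "finite (A h')" "card (A h') \<le> t" using assms(1) by (auto simp: valid_adversary_def)
  have "card (E \<union> A h') \<le> card E + t" using card_Un_le[of E "A h'"] A by simp
  with Cons.IH[of "E \<union> A h'" h'] Cons.prems A show ?case by (simp add: h'_def[symmetric] Let_def)
qed simp

lemma run_history_mono: "set h \<subseteq> set (snd (run A f (E, h) xs))"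
proof (induction xs arbitrary: E h)
  case (Cons x xs)
  define h' where "h' = h @ [(x, if x \<in> E then None else Some (f x))]"
  have "set h \<subseteq> set h'" by (auto simp: h'_def)
  with Cons.IH[of h' "E \<union> A h'"] show ?case by (simp add: h'_def[symmetric] Let_def)
qed simp

lemma run_answers: "(x, Some v) \<in> set (snd (run A f (E, h) xs)) \<Longrightarrow> (x, Some v) \<in> set h \<or> v = f x"
proof (induction xs arbitrary: E h)
  case (Cons y xs)
  define h' where "h' = h @ [(y, if y \<in> E then None else Some (f y))]"
  have "(x, Some v) \<in> set h' \<or> v = f x"
    using Cons.IH[of "E \<union> A h'" h'] Cons.prems by (simp add: h'_def[symmetric] Let_def)
  then show ?case by (auto simp: h'_def split: if_splits)
qed simp

lemma run_unerased:
  assumes "i < length xs" "xs ! i \<notin> fst (run A f (E, h) (take i xs))"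
  shows "(xs ! i, Some (f (xs ! i))) \<in> set (snd (run A f (E, h) xs))"
proof -
  obtain E' h' where st: "run A f (E, h) (take i xs) = (E', h')" by fastforce
  define h'' where "h'' = h' @ [(xs ! i, Some (f (xs ! i)))]"
  have "run A f (E, h) xs = run A f (E, h) (take i xs @ xs ! i # drop (Suc i) xs)"
    using assms(1) by (simp add: id_take_nth_drop[symmetric])
  also have "\<dots> = run A f (E' \<union> A h'', h'') (drop (Suc i) xs)"
    using assms(2) by (simp add: st h''_def Let_def)
  finally show ?thesis using run_history_mono[of h'' A f "E' \<union> A h''" "drop (Suc i) xs"]
    by (auto simp: h''_def)
qed

section \<open>Independent blocks and the global decision rule\<close>

definition explained :: "nat \<Rightarrow> nat \<Rightarrow> nat \<Rightarrow> hist \<Rightarrow> bool" where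
  "explained p n d h \<longleftrightarrow> (\<exists>G. is_fn p n G \<and> deg_le p n d G \<and> (\<forall>x v. (x, Some v) \<in> set h \<longrightarrow> G x = v))"

definition agrees :: "nat \<Rightarrow> nat \<Rightarrow> nat \<Rightarrow> (nat list \<Rightarrow> nat) \<Rightarrow> nat list list \<Rightarrow> bool" where
  "agrees p n d f xs \<longleftrightarrow> (\<exists>G. is_fn p n G \<and> deg_le p n d G \<and> (\<forall>x\<in>set xs. G x = f x))"

definition block_rejects :: "nat \<Rightarrow> nat \<Rightarrow> nat \<Rightarrow> (nat list \<Rightarrow> nat) \<Rightarrow> (nat list list \<Rightarrow> nat list set) \<Rightarrow> nat list list \<Rightarrow> bool" where
  "block_rejects p n d f Er xs \<longleftrightarrow> (\<forall>i<length xs. xs ! i \<notin> Er (take i xs)) \<and> \<not> agrees p n d f xs"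

text \<open>Each block is a uniform sample \<open>\<omega> \<in> \<Omega>\<close> turned into \<open>s\<close> queries, and rejects with probability at
  least \<open>\<rho>\<close> against every erasure strategy within the total budget.\<close>
definition good_blocks :: "nat \<Rightarrow> nat \<Rightarrow> nat \<Rightarrow> (nat list \<Rightarrow> nat) \<Rightarrow> nat \<Rightarrow> real \<Rightarrow> 'a set \<Rightarrow> ('a \<Rightarrow> nat list list) \<Rightarrow> bool" where
  "good_blocks p n d f K \<rho> \<Omega> blk \<longleftrightarrow> (\<forall>Er. (\<forall>xs. finite (Er xs) \<and> card (Er xs) \<le> K) \<longrightarrow>
     \<rho> \<le> avg \<Omega> (\<lambda>\<omega>. of_bool (block_rejects p n d f Er (blk \<omega>))))"

text \<open>A rejecting block already contains unerased answers that no degree \<open>d\<close>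
  function fits, so no later history can be explained. With \<open>b\<close> blocks left, at most
  \<open>t\<close> erasures per query have been made in the other \<open>B - b\<close>; every block
  therefore starts within the total budget.\<close>

lemma blocks_soundness:
  fixes s B :: nat
  assumes \<Omega>: "finite \<Omega>" "\<Omega> \<noteq> {}" and len: "\<And>\<omega>. \<omega> \<in> \<Omega> \<Longrightarrow> length (blk \<omega>) = s"
    and adv: "valid_adversary t A"
    and good: "good_blocks p n d f (t * (s * B)) \<rho> \<Omega> blk" and \<rho>: "\<rho> \<le> 1"
    and "b \<le> B" "finite E" "card E \<le> t * (s * (B - b))"
  shows "avg (lists_of \<Omega> b) (\<lambda>\<omega>s. of_bool (explained p n d (snd (run A f (E, h) (concat (map blk \<omega>s)))))) \<le> (1 - \<rho>) ^ b"
  using assms(7-)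
proof (induction b arbitrary: E h)
  case 0
  show ?case by simp
next
  case (Suc b)
  \<comment> \<open>The erased set seen inside this block as a function of its own earlier points.
    Beyond length \<open>s\<close> it is set to empty, so that the budget bound holds for every
    list.\<close>
  define Er where "Er xs = (if length xs \<le> s then fst (run A f (E, h) xs) else {})" for xs
  have card_le: "card E + t * s \<le> t * (s * (B - b))"
  proof -
    have "B - b = Suc (B - Suc b)" using Suc.prems by simp
    then show ?thesis using Suc.prems by (simp add: algebra_simps)
  qed
  have Er: "finite (Er xs) \<and> card (Er xs) \<le> t * (s * B)" for xs
  proof (cases "length xs \<le> s")
    case True
    have "card (fst (run A f (E, h) xs)) \<le> card E + t * length xs"
      using run_erased[OF adv Suc.prems(2)] by blast
    also have "\<dots> \<le> card E + t * s" using True by simp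
    also have "\<dots> \<le> t * (s * B)" using card_le by (rule order_trans) (intro mult_le_mono diff_le_self order_refl)
    finally show ?thesis using True run_erased[OF adv Suc.prems(2)] by (simp add: Er_def)
  qed (simp add: Er_def)
  define rej where "rej \<omega> = block_rejects p n d f Er (blk \<omega>)" for \<omega>
  have step: "avg (lists_of \<Omega> b) (\<lambda>\<omega>s. of_bool (explained p n d (snd (run A f (E, h) (concat (map blk (\<omega> # \<omega>s)))))))
      \<le> (1 - \<rho>) ^ b * (1 - of_bool (rej \<omega>))" if \<omega>: "\<omega> \<in> \<Omega>" for \<omega>
  proof -
    obtain E' h' where st: "run A f (E, h) (blk \<omega>) = (E', h')" by fastforce
    have E': "finite E'" "card E' \<le> t * (s * (B - b))"
      using run_erased[OF adv Suc.prems(2), of f h "blk \<omega>"] st len[OF \<omega>] card_le by auto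
    have run: "run A f (E, h) (concat (map blk (\<omega> # \<omega>s))) = run A f (E', h') (concat (map blk \<omega>s))" for \<omega>s
      by (simp add: st)
    show ?thesis
    proof (cases "rej \<omega>")
      case True
      have "\<not> explained p n d (snd (run A f (E', h') xs))" for xs
      proof
        assume "explained p n d (snd (run A f (E', h') xs))"
        then obtain G where G: "is_fn p n G" "deg_le p n d G"
          "\<And>x v. (x, Some v) \<in> set (snd (run A f (E', h') xs)) \<Longrightarrow> G x = v" by (auto simp: explained_def)
        have "G x = f x" if x: "x \<in> set (blk \<omega>)" for x
        proof -
          obtain i where i: "i < length (blk \<omega>)" "x = blk \<omega> ! i" using x unfolding in_set_conv_nth by blast
          have "blk \<omega> ! i \<notin> Er (take i (blk \<omega>))" using True i by (simp add: rej_def block_rejects_def)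
          then have "blk \<omega> ! i \<notin> fst (run A f (E, h) (take i (blk \<omega>)))"
            using len[OF \<omega>] by (simp add: Er_def)
          from run_unerased[OF i(1) this] have "(x, Some (f x)) \<in> set h'" by (simp add: st i(2))
          then show ?thesis using run_history_mono[of h' A f E' xs] by (intro G(3)) auto
        qed
        with G have "agrees p n d f (blk \<omega>)" by (auto simp: agrees_def)
        with True show False by (simp add: rej_def block_rejects_def)
      qed
      then show ?thesis using True by (simp add: run avg_def del: concat.simps list.map)
    next
      case False
      then show ?thesis
        using Suc.IH[of E' h'] E' Suc.prems(1) by (simp add: run del: concat.simps list.map)
    qed
  qed
  have "avg (lists_of \<Omega> (Suc b)) (\<lambda>\<omega>s. of_bool (explained p n d (snd (run A f (E, h) (concat (map blk \<omega>s))))))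
     \<le> avg \<Omega> (\<lambda>\<omega>. (1 - \<rho>) ^ b * (1 - of_bool (rej \<omega>)))"
    unfolding avg_lists_Suc by (rule avg_mono) (rule step)
  also have "\<dots> = (1 - \<rho>) ^ b * (1 - avg \<Omega> (\<lambda>\<omega>. of_bool (rej \<omega>)))"
    unfolding avg_cmult avg_diff using \<Omega> by simp
  also have "\<dots> \<le> (1 - \<rho>) ^ b * (1 - \<rho>)"
  proof (intro mult_left_mono)
    have "\<rho> \<le> avg \<Omega> (\<lambda>\<omega>. of_bool (block_rejects p n d f Er (blk \<omega>)))"
      using good Er unfolding good_blocks_def by blast
    then show "1 - avg \<Omega> (\<lambda>\<omega>. of_bool (rej \<omega>)) \<le> 1 - \<rho>" by (simp add: rej_def)
  qed (use \<rho> in simp)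
  finally show ?case by (simp add: mult.commute)
qed

text \<open>Completeness is exact because unerased answers are values of \<open>f\<close>, so
  \<open>f\<close> itself explains every history.\<close>

lemma tester_from_blocks:
  fixes s B :: nat
  assumes \<Omega>: "finite \<Omega>" "\<Omega> \<noteq> {}" and len: "\<And>\<omega>. \<omega> \<in> \<Omega> \<Longrightarrow> length (blk \<omega>) = s"
    and good: "\<And>f. is_fn p n f \<Longrightarrow> far_from_deg p n d \<delta> f \<Longrightarrow> good_blocks p n d f (t * (s * B)) \<rho> \<Omega> blk"
    and \<rho>: "\<rho> \<le> 1" and B: "(1 - \<rho>) ^ B \<le> 1 / 3"
  shows "\<exists>T. query_bounded T (s * B) \<and>
     (\<forall>f A. is_fn p n f \<and> deg_le p n d f \<and> valid_adversary t A \<longrightarrow> accept_prob T (s * B) A f = 1) \<and>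
     (\<forall>f A. is_fn p n f \<and> far_from_deg p n d \<delta> f \<and> valid_adversary t A \<longrightarrow> reject_prob T (s * B) A f \<ge> 2 / 3)"
proof -
  let ?L = "lists_of \<Omega> B"
  define qs where "qs \<omega>s = concat (map blk \<omega>s)" for \<omega>s
  define D where "D = map_pmf qs (pmf_of_set ?L)"
  define T where "T = replay D (s * B) (explained p n d)"
  have L: "finite ?L" "?L \<noteq> {}" using \<Omega> by (auto simp: lists_of_eq_empty_iff)
  have "length (qs \<omega>s) = s * length \<omega>s" if "set \<omega>s \<subseteq> \<Omega>" for \<omega>s
    using that by (induction \<omega>s) (auto simp: qs_def len)
  then have lenD: "length xs = s * B" if "xs \<in> set_pmf D" for xs
    using that L by (auto simp: D_def lists_of_def)
  have "cond_pmf D UNIV = D"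
    by (rule pmf_eqI) (simp add: pmf_cond set_pmf_not_empty)
  have ex: "exec T A f {} [] (s * B) = map_pmf (\<lambda>\<omega>s. explained p n d (snd (run A f ({}, []) (qs \<omega>s)))) (pmf_of_set ?L)" for A f
  proof -
    have "exec T A f {} [] (s * B) =
      map_pmf (\<lambda>xs. explained p n d (snd (run A f ({}, []) (drop (length ([] :: hist)) xs))))
        (cond_pmf D {xs. take (length ([] :: hist)) xs = map fst ([] :: hist)})"
      unfolding T_def by (rule exec_replay[OF lenD]) (auto simp: set_pmf_not_empty)
    also have "\<dots> = map_pmf (\<lambda>xs. explained p n d (snd (run A f ({}, []) xs))) D"
      using \<open>cond_pmf D UNIV = D\<close> by simp
    finally show ?thesis by (simp add: D_def map_pmf_comp)
  qed
  have prob: "measure_pmf.prob (exec T A f {} [] (s * B)) {c} =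
      avg ?L (\<lambda>\<omega>s. of_bool (explained p n d (snd (run A f ({}, []) (qs \<omega>s))) = c))" for A f c
    unfolding ex measure_map_pmf measure_pmf_of_set[OF L(2,1)]
    using L by (simp add: avg_def Int_def vimage_def)
  show ?thesis
  proof (intro exI[of _ T] conjI allI impI)
    show "query_bounded T (s * B)" by (auto simp: query_bounded_def T_def replay_def)
    fix f A
    show "accept_prob T (s * B) A f = 1" if "is_fn p n f \<and> deg_le p n d f \<and> valid_adversary t A"
    proof -
      have "explained p n d (snd (run A f ({}, []) xs))" for xs
        unfolding explained_def using that run_answers[of _ _ A f "{}" "[]" xs] by (intro exI[of _ f]) auto
      then show ?thesis unfolding accept_prob_def prob using L by simp
    qed
    show "reject_prob T (s * B) A f \<ge> 2 / 3" if *: "is_fn p n f \<and> far_from_deg p n d \<delta> f \<and> valid_adversary t A"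
    proof -
      have "avg ?L (\<lambda>\<omega>s. of_bool (explained p n d (snd (run A f ({}, []) (qs \<omega>s))))) \<le> (1 - \<rho>) ^ B"
        unfolding qs_def by (rule blocks_soundness[OF \<Omega> len _ good \<rho>]) (use * in auto)
      moreover have "reject_prob T (s * B) A f =
          avg ?L (\<lambda>\<omega>s. 1 - of_bool (explained p n d (snd (run A f ({}, []) (qs \<omega>s)))))"
        unfolding reject_prob_def prob by (intro avg_cong) simp
      ultimately show ?thesis using B L by (simp add: avg_diff)
    qed
  qed
qed

section \<open>Rejection probability of a block\<close>

lemma good_blocks_mono:
  "good_blocks p n d f K \<rho>' \<Omega> blk \<Longrightarrow> \<rho> \<le> \<rho>' \<Longrightarrow> good_blocks p n d f K \<rho> \<Omega> blk"
  unfolding good_blocks_def by (meson order_trans)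

text \<open>The generating function of the total degree factors over the coordinates.\<close>

lemma weighted_list_sum:
  fixes y :: real
  shows "(\<Sum>e\<in>Fpn p m. y ^ sum_list e) = (\<Sum>j<p. y ^ j) ^ m"
proof (induction m)
  case 0
  show ?case by (simp add: Fpn_eq)
next
  case (Suc m)
  have "(\<Sum>e\<in>Fpn p (Suc m). y ^ sum_list e) = (\<Sum>(j, e)\<in>{..<p} \<times> Fpn p m. y ^ sum_list (j # e))"
    unfolding Fpn_eq lists_of_Suc
    by (subst sum.reindex) (auto simp: inj_on_def intro!: sum.cong)
  also have "\<dots> = (\<Sum>j<p. \<Sum>e\<in>Fpn p m. y ^ j * y ^ sum_list e)"
    by (simp add: sum.cartesian_product power_add)
  finally show ?case by (simp add: sum_product Suc[symmetric])
qed

context prime_mod begin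

text \<open>A sample that is not fitted leads to rejection unless some of its points is erased when
  queried. The variable \<open>\<psi>\<close> may identify sample points, hence the separate bound
  \<open>\<kappa>\<close> on its fibers.\<close>

lemma block_reject_ge:
  fixes \<kappa> :: real
  assumes fit: "\<And>ys. agrees p n d f (map \<psi> ys) \<Longrightarrow> fits r d F ys"
    and hit: "\<And>z. avg (vecs p r) (\<lambda>y. of_bool (\<psi> y = z)) \<le> \<kappa>"
    and Er: "\<And>xs. finite (Er xs) \<and> card (Er xs) \<le> K"
  shows "misfit_prob r d m F - Suc m * K * \<kappa>
     \<le> avg (lists_of (vecs p r) (Suc m)) (\<lambda>ys. of_bool (block_rejects p n d f Er (map \<psi> ys)))"
proof -
  let ?L = "lists_of (vecs p r) (Suc m)"
  have "misfit_prob r d m F \<le> avg ?L (\<lambda>ys. of_bool (block_rejects p n d f Er (map \<psi> ys))) +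
      avg ?L (\<lambda>ys. of_bool (\<exists>i<Suc m. \<psi> (ys ! i) \<in> Er (map \<psi> (take i ys))))"
    unfolding misfit_prob_def
  proof (rule avg_of_bool_disj)
    fix ys assume ys: "ys \<in> ?L" and nf: "\<not> fits r d F ys"
    have len: "length ys = Suc m" using ys by (simp add: lists_of_def)
    have "\<not> agrees p n d f (map \<psi> ys)" using fit nf by blast
    then show "block_rejects p n d f Er (map \<psi> ys) \<or> (\<exists>i<Suc m. \<psi> (ys ! i) \<in> Er (map \<psi> (take i ys)))"
      unfolding block_rejects_def by (auto simp: len take_map)
  qed
  also have "avg ?L (\<lambda>ys. of_bool (\<exists>i<Suc m. \<psi> (ys ! i) \<in> Er (map \<psi> (take i ys)))) \<le> Suc m * K * \<kappa>"
    using adaptive_hit_bound[OF V.finite_X V.X_nonempty hit Er, of "Suc m"] by (simp only: of_nat_mult)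
  finally show ?thesis by simp
qed

definition affine_sample :: "nat \<Rightarrow> nat \<Rightarrow> nat \<Rightarrow> ((nat \<Rightarrow> int) \<times> (nat \<Rightarrow> int) list \<times> (nat \<Rightarrow> int) list) set" where
  "affine_sample n r m = vecs p n \<times> lists_of (vecs p n) r \<times> lists_of (vecs p r) (Suc m)"

definition affine_block :: "nat \<Rightarrow> (nat \<Rightarrow> int) \<times> (nat \<Rightarrow> int) list \<times> (nat \<Rightarrow> int) list \<Rightarrow> nat list list" where
  "affine_block n = (\<lambda>(b, cs, ys). map (\<lambda>y. to_list p n (b + lin y cs)) ys)"

lemma good_affine_blocks:
  assumes f: "is_fn p n f" "far_from_deg p n d \<delta> f" and \<delta>: "0 < \<delta>" "\<delta> \<le> 1"
    and m: "enough r d m" and r: "Suc d \<le> r" "r \<le> n"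
  shows "good_blocks p n d f K (\<tau> (Suc d) * \<delta> / 2 ^ (d + 2) - Suc m * K * (2 / p ^ r))
     (affine_sample n r m) (affine_block n)"
  unfolding good_blocks_def
proof (intro allI impI)
  fix Er :: "nat list list \<Rightarrow> nat list set"
  assume Er: "\<forall>xs. finite (Er xs) \<and> card (Er xs) \<le> K"
  let ?X = "vecs p n" and ?L = "lists_of (vecs p n) r"
  define F where "F b cs y = lift p n f (b + lin y cs)" for b cs y
  have "misfit_prob r d m (F b cs) - Suc m * K * kernel_prob n r cs \<le>
      avg (lists_of (vecs p r) (Suc m)) (\<lambda>ys. of_bool (block_rejects p n d f Er (map (\<lambda>y. to_list p n (b + lin y cs)) ys)))"
    if "cs \<in> ?L" for b cs
  proof (rule block_reject_ge)
    have len: "length cs = r" using that by (simp add: lists_of_def)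
    fix ys assume "agrees p n d f (map (\<lambda>y. to_list p n (b + lin y cs)) ys)"
    then obtain G where G: "deg_le p n d G" "\<And>y. y \<in> set ys \<Longrightarrow> G (to_list p n (b + lin y cs)) = f (to_list p n (b + lin y cs))"
      by (auto simp: agrees_def)
    have "vanishing r d (\<lambda>y. lift p n G (b + lin y cs))"
      by (rule deriv_vanish_affine[OF deriv_vanish_lift[OF G(1)] len])
    then show "fits r d (F b cs) ys"
      unfolding fits_def F_def lift_def using G(2) by (intro exI[of _ "\<lambda>y. int (G (to_list p n (b + lin y cs)))"]) simp
  next
    show "avg (vecs p r) (\<lambda>y. of_bool (to_list p n (b + lin y cs) = z)) \<le> kernel_prob n r cs" for z
      using that by (intro fiber_le_kernel) (simp add: lists_of_def)
  qed (use Er in blast)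
  then have "avg ?X (\<lambda>b. avg ?L (\<lambda>cs. misfit_prob r d m (F b cs) - Suc m * K * kernel_prob n r cs)) \<le>
      avg ?X (\<lambda>b. avg ?L (\<lambda>cs. avg (lists_of (vecs p r) (Suc m))
        (\<lambda>ys. of_bool (block_rejects p n d f Er (map (\<lambda>y. to_list p n (b + lin y cs)) ys)))))"
    by (rule avg_mono[OF avg_mono])
  also have "\<dots> = avg (affine_sample n r m) (\<lambda>\<omega>. of_bool (block_rejects p n d f Er (affine_block n \<omega>)))"
    unfolding affine_sample_def affine_block_def avg_Times by simp
  also have "avg ?X (\<lambda>b. avg ?L (\<lambda>cs. misfit_prob r d m (F b cs) - Suc m * K * kernel_prob n r cs))
     = avg ?X (\<lambda>b. avg ?L (\<lambda>cs. misfit_prob r d m (F b cs))) - Suc m * K * avg ?L (kernel_prob n r)"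
    by (simp only: avg_diff avg_cmult avg_const V.finite_X V.X_nonempty simp_thms)
  finally have main: "avg ?X (\<lambda>b. avg ?L (\<lambda>cs. misfit_prob r d m (F b cs))) - Suc m * K * avg ?L (kernel_prob n r)
    \<le> avg (affine_sample n r m) (\<lambda>\<omega>. of_bool (block_rejects p n d f Er (affine_block n \<omega>)))" .
  have "\<tau> (Suc d) * \<delta> \<le> 2 ^ (d + 2) * avg ?X (\<lambda>b. avg ?L (\<lambda>cs. misfit_prob r d m (F b cs)))"
    unfolding F_def using far_reject[OF f \<delta>] misfit_random_affine[OF m lift_periodic r(1), of n f] by (rule order_trans)
  then have "\<tau> (Suc d) * \<delta> / 2 ^ (d + 2) \<le> avg ?X (\<lambda>b. avg ?L (\<lambda>cs. misfit_prob r d m (F b cs)))"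
    by (simp add: divide_le_eq mult.commute)
  \<comment> \<open>Here \<open>r \<le> n\<close> is used: the term for the zero vector,
    \<open>1 / p ^ r\<close>, dominates the collision term \<open>1 / p ^ n\<close>.\<close>
  moreover have "avg ?L (kernel_prob n r) \<le> 2 / p ^ r"
  proof -
    have "real p ^ r \<le> real p ^ n" using r p_ge_2 by (intro power_increasing) auto
    then have "1 / real p ^ n \<le> 1 / real p ^ r" by (intro divide_left_mono) auto
    then show ?thesis using avg_kernel_prob[of n r] by simp
  qed
  then have "Suc m * K * avg ?L (kernel_prob n r) \<le> Suc m * K * (2 / p ^ r)"
    by (intro mult_left_mono) auto
  ultimately show "\<tau> (Suc d) * \<delta> / 2 ^ (d + 2) - Suc m * K * (2 / p ^ r) \<le>
    avg (affine_sample n r m) (\<lambda>\<omega>. of_bool (block_rejects p n d f Er (affine_block n \<omega>)))"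
    using main by linarith
qed

lemma good_uniform_blocks:
  assumes f: "is_fn p n f" "far_from_deg p n d \<delta> f" and \<delta>: "0 < \<delta>" "\<delta> \<le> 1"
    and m: "enough n d m"
  shows "good_blocks p n d f K (\<delta> / 2 - Suc m * K * (1 / p ^ n))
     (lists_of (vecs p n) (Suc m)) (map (to_list p n))"
  unfolding good_blocks_def
proof (intro allI impI)
  fix Er :: "nat list list \<Rightarrow> nat list set"
  assume Er: "\<forall>xs. finite (Er xs) \<and> card (Er xs) \<le> K"
  have "misfit_prob n d m (lift p n f) - Suc m * K * (1 / p ^ n) \<le>
      avg (lists_of (vecs p n) (Suc m)) (\<lambda>ys. of_bool (block_rejects p n d f Er (map (to_list p n) ys)))"
  proof (rule block_reject_ge)
    fix ys assume "agrees p n d f (map (to_list p n) ys)"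
    then obtain G where G: "deg_le p n d G" "\<And>y. y \<in> set ys \<Longrightarrow> G (to_list p n y) = f (to_list p n y)"
      by (auto simp: agrees_def)
    then show "fits n d (lift p n f) ys"
      unfolding fits_def using deriv_vanish_lift[OF G(1)]
      by (intro exI[of _ "lift p n G"]) (simp add: lift_def)
  next
    fix z
    have inj: "inj_on (to_list p n) (vecs p n)" using bij_to_list by (rule bij_betw_imp_inj_on)
    have "card {y \<in> vecs p n. to_list p n y = z} \<le> Suc 0"
      by (subst card_le_Suc0_iff_eq) (use inj in \<open>auto dest: inj_onD\<close>)
    then show "avg (vecs p n) (\<lambda>y. of_bool (to_list p n y = z)) \<le> 1 / p ^ n"
      by (simp add: avg_def Int_def card_vecs divide_right_mono)
  qed (use Er in blast)
  moreover have "\<delta> / 2 \<le> misfit_prob n d m (lift p n f)"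
    using far_dist_mod[OF f] \<delta> by (intro misfit_prob_ge[OF m]) auto
  ultimately show "\<delta> / 2 - Suc m * K * (1 / p ^ n) \<le>
      avg (lists_of (vecs p n) (Suc m)) (\<lambda>ys. of_bool (block_rejects p n d f Er (map (to_list p n) ys)))"
    by linarith
qed

section \<open>Number of samples and of monomials\<close>

text \<open>Chosen so that the union bound over all polynomials is at most \<open>exp (-1)\<close>:
  the logarithmic term pays for their number, the added 1 for the final constant.\<close>

definition samples :: "nat \<Rightarrow> nat \<Rightarrow> nat" where
  "samples r d = nat \<lceil>2 ^ d * (card (low_exps r (Suc d)) * ln p + 1)\<rceil>"

lemma ln_p_nonneg: "0 \<le> ln (real p)"
  using p_ge_2 by simp

lemma samples_le: "samples r d \<le> 2 ^ d * (card (low_exps r (Suc d)) * ln p + 1) + 1"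
proof -
  have "0 \<le> 2 ^ d * (card (low_exps r (Suc d)) * ln p + 1)" using ln_p_nonneg by simp
  then show ?thesis unfolding samples_def by linarith
qed

lemma exp_m1_le_half: "exp (-1 :: real) \<le> 1 / 2"
  using exp_ge_add_one_self[of "1::real"] by (simp add: exp_minus field_simps)

lemma enough_samples: "enough r d (samples r d)"
  unfolding enough_def
proof -
  let ?M = "card (low_exps r (Suc d))" and ?m = "samples r d"
  have m: "2 ^ d * (?M * ln p + 1) \<le> ?m" unfolding samples_def by (rule real_nat_ceiling_ge)
  have "(1 - 1 / 2 ^ d :: real) ^ ?m \<le> exp (- 1 / 2 ^ d) ^ ?m"
    using exp_ge_add_one_self[of "- 1 / 2 ^ d"] by (intro power_mono) auto
  also have "\<dots> = exp (- (?m / 2 ^ d))" by (simp add: exp_of_nat_mult[symmetric])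
  also have "\<dots> \<le> exp (- (?M * ln p + 1))" using m by (simp add: field_simps)
  finally have "real p ^ ?M * (1 - 1 / 2 ^ d) ^ ?m \<le> real p ^ ?M * exp (- (?M * ln p + 1))"
    by (intro mult_left_mono) auto
  also have "\<dots> = exp (?M * ln p) * exp (- (?M * ln p + 1))" by (simp add: exp_of_nat_mult)
  also have "\<dots> = exp (-1)" by (simp flip: exp_add)
  also note exp_m1_le_half
  finally show "real (p ^ ?M) * (1 - 1 / 2 ^ d) ^ ?m \<le> 1 / 2" by simp
qed

text \<open>An exponential-moment bound: every low exponent vector has weight
  \<open>y ^ sum_list e\<close> at least \<open>y ^ d\<close>, while the total weight is a product
  of truncated geometric series. The parameter \<open>y\<close> is left free:
  \<open>1 / (r + 1)\<close> gives a polynomial bound in \<open>r\<close>, and \<open>1 / 16\<close>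
  one uniform in \<open>n\<close>.\<close>

lemma card_low_exps_le:
  fixes y :: real
  assumes y: "0 < y" "y < 1"
  shows "card (low_exps r (Suc d)) \<le> (1 / y) ^ d * (1 / (1 - y)) ^ r"
proof -
  have "card (low_exps r (Suc d)) * y ^ d = (\<Sum>e\<in>low_exps r (Suc d). y ^ d)" by simp
  also have "\<dots> \<le> (\<Sum>e\<in>low_exps r (Suc d). y ^ sum_list e)"
    using y by (intro sum_mono power_decreasing) (auto simp: low_exps_def)
  also have "\<dots> \<le> (\<Sum>e\<in>Fpn p r. y ^ sum_list e)"
    using y by (intro sum_mono2) (auto simp: low_exps_def)
  also have "\<dots> = (\<Sum>j<p. y ^ j) ^ r" by (rule weighted_list_sum)
  also have "\<dots> \<le> (1 / (1 - y)) ^ r"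
  proof (intro power_mono)
    have "(\<Sum>j<p. y ^ j) = (1 - y ^ p) / (1 - y)" using y by (simp add: sum_gp_strict)
    also have "\<dots> \<le> 1 / (1 - y)" using y by (intro divide_right_mono) auto
    finally show "(\<Sum>j<p. y ^ j) \<le> 1 / (1 - y)" .
  qed (use y in \<open>auto intro: sum_nonneg\<close>)
  finally show ?thesis using y by (simp add: field_simps power_divide)
qed

lemma card_low_exps_poly:
  assumes "r > 0" shows "card (low_exps r (Suc d)) \<le> 3 * (real r + 1) ^ d"
proof -
  let ?y = "1 / (real r + 1)"
  have "1 / (1 - ?y) = 1 + 1 / real r" using assms by (simp add: field_simps)
  then have "card (low_exps r (Suc d)) \<le> (1 / ?y) ^ d * (1 + 1 / real r) ^ r"
    using card_low_exps_le[of ?y r d] assms by simp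
  also have "1 / ?y = real r + 1" by simp
  also have "(1 + 1 / real r) ^ r \<le> 3"
  proof -
    have "(1 + 1 / real r) ^ r \<le> exp (1 / real r) ^ r"
      using exp_ge_add_one_self[of "1 / real r"] by (intro power_mono) auto
    also have "\<dots> = exp 1" using assms by (simp add: exp_of_nat_mult[symmetric])
    also have "\<dots> \<le> 3" by (rule exp_le)
    finally show ?thesis .
  qed
  finally show ?thesis by (simp add: mult_left_mono mult.commute)
qed

end

lemma power_one_minus_le_third:
  fixes \<rho> :: real
  assumes "0 \<le> \<rho>" "\<rho> \<le> 1" "2 \<le> \<rho> * B" shows "(1 - \<rho>) ^ B \<le> 1 / 3"
proof -
  have "(1 - \<rho>) ^ B \<le> exp (- \<rho>) ^ B"
    using exp_ge_add_one_self[of "- \<rho>"] assms by (intro power_mono) auto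
  also have "\<dots> = exp (- (\<rho> * B))" by (simp add: exp_of_nat_mult[symmetric] mult.commute)
  also have "\<dots> \<le> exp (- 2)" using assms by simp
  also have "\<dots> \<le> 1 / 3"
    using exp_ge_add_one_self[of "2::real"] by (simp add: exp_minus field_simps)
  finally show ?thesis .
qed

section \<open>Choice of parameters\<close>

definition valid_tester :: "nat \<Rightarrow> nat \<Rightarrow> nat \<Rightarrow> real \<Rightarrow> nat \<Rightarrow> (hist \<Rightarrow> action pmf) \<Rightarrow> nat \<Rightarrow> bool" where
  "valid_tester p n d \<delta> t T q \<longleftrightarrow> query_bounded T q \<and>
     (\<forall>f A. is_fn p n f \<and> deg_le p n d f \<and> valid_adversary t A \<longrightarrow> accept_prob T q A f = 1) \<and>
     (\<forall>f A. is_fn p n f \<and> far_from_deg p n d \<delta> f \<and> valid_adversary t A \<longrightarrow> reject_prob T q A f \<ge> 2 / 3)"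

context prime_mod begin

text \<open>The quantity \<open>W\<close> is \<open>p\<close> to the power \<open>n / 20\<close>. Up
  to factors absorbed in \<open>W\<close>, the only exponential contribution is
  \<open>(16 / 15) ^ n\<close>, which stays below \<open>W ^ 2\<close>.\<close>

lemma uniform_sample_size:
  fixes W :: real
  assumes "n > 0" "d > 0" and W: "W ^ 20 = real p ^ n" "W \<ge> 30 ^ d"
  shows "Suc (samples n d) \<le> W ^ 7"
proof -
  have "(30::real) ^ 1 \<le> 30 ^ d" using assms by (intro power_increasing) auto
  then have W30: "30 \<le> W" using W by simp
  have "(2::real) ^ d \<le> 30 ^ d" "(16::real) ^ d \<le> 30 ^ d" by (intro power_mono; simp)+
  then have d2: "2 ^ d \<le> W" and d16: "16 ^ d \<le> W" using W by auto
  have "card (low_exps n (Suc d)) \<le> 16 ^ d * (16 / 15) ^ n"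
    using card_low_exps_le[of "1 / 16" n d] by simp
  also have "(16 / 15) ^ n \<le> W ^ 2"
  proof (rule power_le_imp_le_base[where n = 9])
    have "((16 / 15 :: real) ^ n) ^ Suc 9 = ((16 / 15) ^ 10) ^ n"
      by (simp add: power_mult[symmetric] mult.commute)
    \<comment> \<open>The tenth power of \<open>16 / 15\<close> is below \<open>2\<close>, the least
      possible \<open>p\<close>.\<close>
    also have "\<dots> \<le> real p ^ n"
      using p_ge_2 by (intro power_mono) (auto simp: power_divide)
    also have "\<dots> = (W ^ 2) ^ Suc 9" by (simp add: W(1)[symmetric] power_mult[symmetric])
    finally show "((16 / 15 :: real) ^ n) ^ Suc 9 \<le> (W ^ 2) ^ Suc 9" .
  qed simp
  also have "16 ^ d * W ^ 2 \<le> W * W ^ 2" using d16 by (intro mult_right_mono) auto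
  finally have M: "card (low_exps n (Suc d)) \<le> W ^ 3" by (simp add: power3_eq_cube power2_eq_square mult.assoc)
  have "ln p \<le> n * ln p" using assms ln_p_nonneg by (cases n) (auto simp: algebra_simps)
  also have "\<dots> = ln (W ^ 20)" unfolding W(1) using p_pos by (simp add: ln_realpow)
  also have "\<dots> = 20 * ln W" using W30 by (simp add: ln_realpow)
  also have "\<dots> \<le> 20 * W" using ln_le_minus_one[of W] W30 by simp
  also have "\<dots> \<le> W ^ 2" using W30 by (simp add: power2_eq_square)
  finally have lnp: "ln p \<le> W ^ 2" .
  have "samples n d \<le> 2 ^ d * (card (low_exps n (Suc d)) * ln p + 1) + 1" by (rule samples_le)
  also have "\<dots> \<le> W * (W ^ 3 * W ^ 2 + 1) + 1"
    using M lnp d2 ln_p_nonneg W30 by (intro add_mono mult_mono) auto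
  finally have "Suc (samples n d) \<le> W ^ 6 + W + 2" by (simp add: algebra_simps flip: power_add power_Suc)
  also have "\<dots> \<le> W ^ 6 + W ^ 6 + W ^ 6"
  proof -
    have "W ^ 1 \<le> W ^ 6" using W30 by (intro power_increasing) auto
    then show ?thesis using W30 by simp
  qed
  also have "\<dots> = 3 * W ^ 6" by simp
  also have "\<dots> \<le> W * W ^ 6" using W30 by (intro mult_right_mono) auto
  finally show ?thesis by (simp flip: power_Suc)
qed

lemma uniform_tester:
  fixes \<delta> :: real
  assumes n: "n > 0" and d: "d > 0" and \<delta>: "0 < \<delta>" "\<delta> \<le> 1"
    and t: "real t \<le> \<delta> / 30 * real p powr (real n / (20 * real d))"
  shows "\<exists>T q. real q \<le> Suc (samples n d) * (9 / \<delta>) \<and> valid_tester p n d \<delta> t T q"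
proof -
  define s where "s = Suc (samples n d)"
  \<comment> \<open>Each block will reject with probability at least \<open>\<delta> / 4\<close>,
    and the number of blocks times this must be at least 2.\<close>
  define B where "B = nat \<lceil>8 / \<delta>\<rceil>"
  have B: "8 / \<delta> \<le> B" unfolding B_def by (rule real_nat_ceiling_ge)
  have "B \<le> 8 / \<delta> + 1" unfolding B_def using \<delta> by simp
  also have "\<dots> \<le> 9 / \<delta>" using \<delta> by (simp add: field_simps)
  finally have B': "B \<le> 9 / \<delta>" .
  \<comment> \<open>Each of \<open>s\<close> queries in a block faces at most
    \<open>t * (s * B)\<close> erased points. The two factors \<open>s\<close> cost
    \<open>W ^ 14\<close>, which leaves \<open>W ^ 6\<close> of \<open>p ^ n = W ^ 20\<close> for
    the dependence on \<open>t\<close> and \<open>\<delta>\<close>.\<close>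
  have bound: "real (s * (t * (s * B))) * (1 / p ^ n) \<le> \<delta> / 4"
  proof (cases "t = 0")
    case True
    then show ?thesis using \<delta> by simp
  next
    case False
    then have t1: "1 \<le> real t" by simp
    define L where "L = real p powr (real n / (20 * real d))"
    define W where "W = L ^ d"
    have tL: "t / \<delta> \<le> L / 30" using t \<delta> by (simp add: L_def field_simps)
    \<comment> \<open>A nonzero \<open>t\<close> turns the hypothesis on \<open>t\<close> into a
      bound on \<open>1 / \<delta>\<close> as well, and forces \<open>30 \<le> L\<close>.\<close>
    have d1: "1 / \<delta> \<le> t / \<delta>" using t1 \<delta> by (simp add: divide_right_mono)
    have "1 \<le> 1 / \<delta>" using \<delta> by simp
    then have L30: "30 \<le> L" using tL d1 by linarith
    have W30: "30 ^ d \<le> W" unfolding W_def using L30 by (intro power_mono) auto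
    have "L ^ 1 \<le> L ^ d" using L30 d by (intro power_increasing) auto
    then have LW: "L \<le> W" by (simp add: W_def)
    have "W ^ 20 = L ^ (d * 20)" unfolding W_def by (simp add: power_mult)
    also have "\<dots> = L powr (real (d * 20))" using L30 by (subst powr_realpow) auto
    also have "\<dots> = real p powr real n" unfolding L_def powr_powr using d by simp
    also have "\<dots> = real p ^ n" by (simp add: powr_realpow)
    finally have W20: "W ^ 20 = real p ^ n" .
    have s: "s \<le> W ^ 7" unfolding s_def by (rule uniform_sample_size[OF n d W20 W30])
    have Wpos: "30 \<le> W" using L30 LW by simp
    have tW: "t / \<delta> \<le> W / 30" and dW: "1 / \<delta> \<le> W / 30" using tL d1 LW by linarith+
    have "36 * (t / \<delta>) * (1 / \<delta>) \<le> 36 * (W / 30) * (W / 30)"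
      by (intro mult_mono tW dW) (use \<delta> Wpos in auto)
    also have "\<dots> \<le> W ^ 2" by (simp add: power2_eq_square)
    also have "\<dots> \<le> W ^ 6" using Wpos by (intro power_increasing) auto
    finally have key: "36 * (t / \<delta>) * (1 / \<delta>) \<le> W ^ 6" .
    have "real (s * (t * (s * B))) = (real s * real s) * (real t * real B)" by (simp add: mult_ac)
    also have "\<dots> \<le> (W ^ 7 * W ^ 7) * (t * (9 / \<delta>))"
      using s B' Wpos by (intro mult_mono) auto
    also have "\<dots> = (W ^ 14 * (\<delta> / 4)) * (36 * (t / \<delta>) * (1 / \<delta>))"
      using \<delta> by (simp add: field_simps flip: power_add)
    also have "\<dots> \<le> (W ^ 14 * (\<delta> / 4)) * W ^ 6"
      using key \<delta> Wpos by (intro mult_left_mono) auto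
    also have "\<dots> = (\<delta> / 4) * p ^ n" by (simp add: W20[symmetric] mult_ac flip: power_add)
    finally show ?thesis by (simp add: divide_le_eq)
  qed
  have "\<exists>T. query_bounded T (s * B) \<and>
     (\<forall>f A. is_fn p n f \<and> deg_le p n d f \<and> valid_adversary t A \<longrightarrow> accept_prob T (s * B) A f = 1) \<and>
     (\<forall>f A. is_fn p n f \<and> far_from_deg p n d \<delta> f \<and> valid_adversary t A \<longrightarrow> reject_prob T (s * B) A f \<ge> 2 / 3)"
  proof (rule tester_from_blocks[where \<rho> = "\<delta> / 4" and blk = "map (to_list p n)" and \<Omega> = "lists_of (vecs p n) s"])
    fix f assume f: "is_fn p n f" "far_from_deg p n d \<delta> f"
    show "good_blocks p n d f (t * (s * B)) (\<delta> / 4) (lists_of (vecs p n) s) (map (to_list p n))"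
      using good_uniform_blocks[OF f \<delta> enough_samples, of "t * (s * B)"] bound
      unfolding s_def by (elim good_blocks_mono) simp
  next
    show "(1 - \<delta> / 4) ^ B \<le> 1 / 3"
      using B \<delta> by (intro power_one_minus_le_third) (auto simp: field_simps)
    show "length (map (to_list p n) \<omega>) = s" if "\<omega> \<in> lists_of (vecs p n) s" for \<omega>
      using that by (simp add: lists_of_def)
  qed (use \<delta> in simp_all)
  then obtain T where "valid_tester p n d \<delta> t T (s * B)" by (auto simp: valid_tester_def)
  moreover have "real (s * B) \<le> s * (9 / \<delta>)" using B' by (simp add: mult_left_mono del: times_divide_eq_right)
  ultimately show ?thesis unfolding s_def by blast
qed

lemma affine_sample_size:
  assumes "r > 0"
  shows "Suc (samples r d) \<le> (2 ^ d * (3 * ln p + 1) + 2) * (real r + 1) ^ d"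
proof -
  let ?R = "(real r + 1) ^ d"
  have R1: "1 \<le> ?R" by simp
  have "samples r d \<le> 2 ^ d * (card (low_exps r (Suc d)) * ln p + 1) + 1" by (rule samples_le)
  also have "\<dots> \<le> 2 ^ d * (3 * ?R * ln p + ?R) + ?R"
    using card_low_exps_poly[OF assms, of d] ln_p_nonneg R1
    by (intro add_mono mult_left_mono mult_right_mono) auto
  finally have "Suc (samples r d) \<le> 2 ^ d * (3 * ?R * ln p + ?R) + ?R + ?R"
    unfolding of_nat_Suc using R1 by linarith
  then show ?thesis by (simp add: algebra_simps)
qed

text \<open>One half of the exponent of \<open>p ^ r\<close> pays for the squared block size
  (\<open>growth\<close>), the other half for \<open>t / \<delta>\<^sup>2\<close>
  (\<open>rt\<close>). The constant \<open>20\<close> is \<open>4 * 5\<close>, from the slack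
  \<open>c1 * \<delta> / 4\<close> and the bound \<open>5 / (c1 * \<delta>)\<close> on the number of
  blocks.\<close>

lemma affine_tester:
  fixes \<delta> c1 c2 :: real and d :: nat
  defines "c1 \<equiv> \<tau> (Suc d) / 2 ^ (d + 2)" and "c2 \<equiv> 2 ^ d * (3 * ln p + 1) + 2"
  assumes \<delta>: "0 < \<delta>" "\<delta> \<le> 1" and r: "Suc d \<le> r" "r \<le> n"
    and growth: "20 * c2\<^sup>2 / c1\<^sup>2 * (real r + 1) ^ (2 * d) \<le> p powr (r / 2)"
    and rt: "4 * log p (t / \<delta>) \<le> r"
  shows "\<exists>T q. real q \<le> 5 * c2 / c1 * (real r + 1) ^ d / \<delta> \<and> valid_tester p n d \<delta> t T q"
proof -
  define s where "s = Suc (samples r d)"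
  define B where "B = nat \<lceil>4 / (c1 * \<delta>)\<rceil>"
  let ?R = "real r + 1"
  have c1: "0 < c1" unfolding c1_def using \<tau>_pos[of "Suc d"] by simp
  have "\<tau> (Suc d) \<le> 1"
  proof -
    have "1 \<le> (2::real) ^ Suc d" by (rule one_le_power) simp
    moreover have "1 \<le> real (Suc d) + 2 ^ Suc d" by simp
    ultimately have "(1::real) * 1 \<le> 2 ^ Suc d * (real (Suc d) + 2 ^ Suc d)"
      by (intro mult_mono) simp_all
    then show ?thesis unfolding \<tau>_def by (subst divide_le_eq_1) auto
  qed
  moreover have "(1::real) \<le> 2 ^ (d + 2)" by (rule one_le_power) simp
  ultimately have c1': "c1 \<le> 1" unfolding c1_def by (subst divide_le_eq_1) auto
  have c2: "0 < c2" unfolding c2_def using ln_p_nonneg by (intro add_nonneg_pos mult_nonneg_nonneg) auto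
  have cd: "0 < c1 * \<delta>" "c1 * \<delta> \<le> 1" using c1 c1' \<delta> by (auto intro: mult_le_one)
  have B: "4 / (c1 * \<delta>) \<le> B" unfolding B_def by (rule real_nat_ceiling_ge)
  have "B \<le> 4 / (c1 * \<delta>) + 1" unfolding B_def using cd by simp
  also have "\<dots> \<le> 4 / (c1 * \<delta>) + 1 / (c1 * \<delta>)"
    by (rule add_left_mono) (use cd in \<open>simp only: le_divide_eq_1_pos\<close>)
  finally have B': "B \<le> 5 / (c1 * \<delta>)" by (simp add: add_divide_distrib[symmetric])
  have s: "s \<le> c2 * ?R ^ d" unfolding s_def c2_def using r by (intro affine_sample_size) auto
  have bound: "real (s * (t * (s * B))) * (2 / p ^ r) \<le> c1 * \<delta> / 2"
  proof (cases "t = 0")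
    case True
    then show ?thesis using cd by simp
  next
    case False
    then have t1: "1 \<le> real t" by simp
    have pr: "real p ^ r = p powr (r / 2) * p powr (r / 2)"
      by (simp flip: powr_add add: powr_realpow)
    have "t / \<delta>\<^sup>2 \<le> (t / \<delta>) ^ 2"
      using t1 \<delta> by (simp add: power_divide divide_right_mono self_le_power)
    also have "\<dots> = (p powr log p (t / \<delta>)) ^ 2" using t1 \<delta> p_ge_2 by simp
    also have "\<dots> = p powr (2 * log p (t / \<delta>))" by (simp add: powr_power mult.commute)
    also have "\<dots> \<le> p powr (r / 2)" using rt p_ge_2 by (intro powr_mono) auto
    finally have tt: "t / \<delta>\<^sup>2 \<le> p powr (r / 2)" .
    have "real (s * (t * (s * B))) = (real s * real s) * (real t * real B)" by (simp add: mult_ac)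
    also have "\<dots> \<le> ((c2 * ?R ^ d) * (c2 * ?R ^ d)) * (t * (5 / (c1 * \<delta>)))"
      using s B' c2 by (intro mult_mono) auto
    also have "\<dots> = (c1 * \<delta> / 4) * ((20 * c2\<^sup>2 / c1\<^sup>2 * ?R ^ (2 * d)) * (t / \<delta>\<^sup>2))"
      unfolding mult_2[of d] power_add using c1 \<delta> by (simp add: field_simps power2_eq_square)
    also have "\<dots> \<le> (c1 * \<delta> / 4) * (p powr (r / 2) * p powr (r / 2))"
      using growth tt cd by (intro mult_left_mono mult_mono) auto
    also have "\<dots> = (c1 * \<delta> / 4) * p ^ r" using pr by simp
    finally have "real (s * (t * (s * B))) * (2 / p ^ r) \<le> (c1 * \<delta> / 4) * p ^ r * (2 / p ^ r)"
      by (intro mult_right_mono) auto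
    also have "\<dots> = c1 * \<delta> / 2" using p_ge_2 by simp
    finally show ?thesis .
  qed
  have "\<exists>T. query_bounded T (s * B) \<and>
     (\<forall>f A. is_fn p n f \<and> deg_le p n d f \<and> valid_adversary t A \<longrightarrow> accept_prob T (s * B) A f = 1) \<and>
     (\<forall>f A. is_fn p n f \<and> far_from_deg p n d \<delta> f \<and> valid_adversary t A \<longrightarrow> reject_prob T (s * B) A f \<ge> 2 / 3)"
  proof (rule tester_from_blocks[where \<rho> = "c1 * \<delta> / 2" and blk = "affine_block n" and \<Omega> = "affine_sample n r (samples r d)"])
    fix f assume f: "is_fn p n f" "far_from_deg p n d \<delta> f"
    show "good_blocks p n d f (t * (s * B)) (c1 * \<delta> / 2) (affine_sample n r (samples r d)) (affine_block n)"
      using good_affine_blocks[OF f \<delta> enough_samples r, of "t * (s * B)"]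
    proof (rule good_blocks_mono)
      have half: "c / 2 \<le> x - y" if "x = c" "y \<le> c / 2" for x y c :: real using that by simp
      have "\<tau> (Suc d) * \<delta> / 2 ^ (d + 2) = c1 * \<delta>" by (simp add: c1_def)
      then show "c1 * \<delta> / 2 \<le> \<tau> (Suc d) * \<delta> / 2 ^ (d + 2) - real (Suc (samples r d) * (t * (s * B))) * (2 / real (p ^ r))"
        using half[OF _ bound] unfolding s_def[symmetric] by blast
    qed
  next
    show "(1 - c1 * \<delta> / 2) ^ B \<le> 1 / 3"
      using B cd by (intro power_one_minus_le_third) (auto simp: field_simps)
    show "length (affine_block n \<omega>) = s" if "\<omega> \<in> affine_sample n r (samples r d)" for \<omega>
      using that by (auto simp: affine_block_def affine_sample_def s_def lists_of_def)
    show "finite (affine_sample n r (samples r d))" "affine_sample n r (samples r d) \<noteq> {}"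
      by (simp_all add: affine_sample_def)
  qed (use cd in simp)
  then obtain T where "valid_tester p n d \<delta> t T (s * B)" by (auto simp: valid_tester_def)
  moreover have "real (s * B) \<le> 5 * c2 / c1 * ?R ^ d / \<delta>"
  proof -
    have "real (s * B) \<le> (c2 * ?R ^ d) * (5 / (c1 * \<delta>))"
      unfolding of_nat_mult using s B' c2 by (intro mult_mono) auto
    then show ?thesis by (simp add: mult_ac)
  qed
  ultimately show ?thesis by blast
qed

end

theorem theorem1p1:
  fixes p d :: nat
  assumes "prime p" and "d > 0"
  shows "\<exists>C::real. C > 0 \<and>
    (\<forall>(n::nat) (\<delta>::real) (t::nat).
       n > 0 \<and> 0 < \<delta> \<and> \<delta> \<le> 1 \<and>
       real t \<le> \<delta> / 30 * real p powr (real n / (20 * real d)) \<longrightarrow>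
       (\<exists>(T :: hist \<Rightarrow> action pmf) (q::nat).
          real q \<le> C * (1 + ln (1 + real t / \<delta>)) ^ (3 * d + 3) / \<delta> \<and>
          query_bounded T q \<and>
          (\<forall>f A. is_fn p n f \<and> deg_le p n d f \<and> valid_adversary t A \<longrightarrow>
                 accept_prob T q A f = 1) \<and>
          (\<forall>f A. is_fn p n f \<and> far_from_deg p n d \<delta> f \<and> valid_adversary t A \<longrightarrow>
                 reject_prob T q A f \<ge> 2/3)))"
proof -
  interpret prime_mod p by unfold_locales (rule assms(1))
  define c1 where "c1 = \<tau> (Suc d) / 2 ^ (d + 2)"
  define c2 where "c2 = 2 ^ d * (3 * ln p + 1) + 2"
  have c1: "0 < c1" unfolding c1_def using \<tau>_pos[of "Suc d"] by simp
  have c2: "0 < c2" unfolding c2_def using ln_p_nonneg by (intro add_nonneg_pos mult_nonneg_nonneg) auto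
  have "0 < 20 * c2\<^sup>2 / c1\<^sup>2" "1 < real p" using c1 c2 p_ge_2 by auto
  then have "eventually (\<lambda>r::nat. 20 * c2\<^sup>2 / c1\<^sup>2 * (real r + 1) ^ (2 * d) \<le> real p powr (real r / 2)) sequentially"
    by real_asymp
  then obtain r0 where r0: "\<And>r. r \<ge> r0 \<Longrightarrow> 20 * c2\<^sup>2 / c1\<^sup>2 * (real r + 1) ^ (2 * d) \<le> real p powr (real r / 2)"
    unfolding eventually_sequentially by blast
  define r1 where "r1 = max r0 (Suc d)"
  define c3 where "c3 = real r1 + 10"
  \<comment> \<open>Summing over all dimensions below the threshold bounds the block size in each of
    them by a constant depending only on \<open>p\<close> and \<open>d\<close>.\<close>
  define C1 where "C1 = 9 * (\<Sum>n<r1. real (Suc (samples n d)))"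
  define C2 where "C2 = 5 * c2 / c1 * c3 ^ d"
  have C1: "0 \<le> C1" unfolding C1_def by (intro mult_nonneg_nonneg sum_nonneg) auto
  have C2: "0 < C2" unfolding C2_def c3_def using c1 c2 by (intro mult_pos_pos divide_pos_pos zero_less_power) auto
  show ?thesis
  proof (intro exI[of _ "C1 + C2"] conjI allI impI)
    show "0 < C1 + C2" using C1 C2 by simp
    fix n t :: nat and \<delta> :: real
    assume as: "n > 0 \<and> 0 < \<delta> \<and> \<delta> \<le> 1 \<and> real t \<le> \<delta> / 30 * real p powr (real n / (20 * real d))"
    then have \<delta>: "0 < \<delta>" "\<delta> \<le> 1" by auto
    define \<Lambda> where "\<Lambda> = 1 + ln (1 + real t / \<delta>)"
    have \<Lambda>1: "1 \<le> \<Lambda>" unfolding \<Lambda>_def using \<delta> by simp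
    have "\<exists>T q. real q \<le> (C1 + C2) * \<Lambda> ^ (3 * d + 3) / \<delta> \<and> valid_tester p n d \<delta> t T q"
    proof (cases "n < r1")
      case True
      obtain T q where q: "real q \<le> Suc (samples n d) * (9 / \<delta>)" "valid_tester p n d \<delta> t T q"
        using uniform_tester[of n d \<delta> t] as assms by blast
      note q(1)
      also have "Suc (samples n d) * (9 / \<delta>) \<le> C1 / \<delta>"
      proof -
        have "real (Suc (samples n d)) \<le> (\<Sum>n<r1. real (Suc (samples n d)))"
          using True by (intro member_le_sum) auto
        then show ?thesis unfolding C1_def using \<delta> by (simp add: divide_right_mono)
      qed
      also have "\<dots> \<le> (C1 + C2) * \<Lambda> ^ (3 * d + 3) / \<delta>"
      proof (rule divide_right_mono)
        have "C1 * 1 \<le> (C1 + C2) * \<Lambda> ^ (3 * d + 3)"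
          using C1 C2 \<Lambda>1 by (intro mult_mono one_le_power) auto
        then show "C1 \<le> (C1 + C2) * \<Lambda> ^ (3 * d + 3)" by simp
      qed (use \<delta> in simp)
      finally show ?thesis using q(2) by blast
    next
      case False
      define r where "r = max r1 (nat \<lceil>4 * log p (t / \<delta>)\<rceil>)"
      \<comment> \<open>The hypothesis on \<open>t\<close> gives
        \<open>log p (t / \<delta>) \<le> n / (20 * d)\<close>, more than enough for
        \<open>r\<close> to fit into dimension \<open>n\<close>. For \<open>t = 0\<close> the
        logarithm takes its default value \<open>0\<close>.\<close>
      have log_le: "4 * log p (t / \<delta>) \<le> n"
      proof (cases "t = 0")
        case False
        then have pos: "0 < t / \<delta>" using \<delta> by simp
        have "t / \<delta> \<le> real p powr (real n / (20 * real d)) / 30" using as by (simp add: field_simps)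
        also have "\<dots> \<le> real p powr (real n / (20 * real d))" by simp
        finally have "log p (t / \<delta>) \<le> log p (real p powr (real n / (20 * real d)))"
          using pos p_ge_2 by (subst log_le_cancel_iff) auto
        also have "\<dots> = real n / (20 * real d)" using p_ge_2 by simp
        also have "\<dots> \<le> real n / 4" using assms(2) by (intro divide_left_mono) auto
        finally show ?thesis by simp
      qed (simp add: log_def)
      then have rn: "r \<le> n" using False unfolding r_def by (simp add: nat_le_iff ceiling_le_iff)
      have rt: "4 * log p (t / \<delta>) \<le> r"
        using real_nat_ceiling_ge[of "4 * log p (t / \<delta>)"] unfolding r_def by (simp add: max_def)
      have "r0 \<le> r" "Suc d \<le> r" by (auto simp: r_def r1_def)
      with affine_tester[of \<delta> d r n t, folded c1_def c2_def] rn rt r0 \<delta>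
      obtain T q where q: "real q \<le> 5 * c2 / c1 * (real r + 1) ^ d / \<delta>" "valid_tester p n d \<delta> t T q"
        by blast
      \<comment> \<open>Since \<open>ln p \<ge> 1 / 2\<close>, four times the logarithm to base
        \<open>p\<close> is at most eight natural logarithms; \<open>c3 = r1 + 10\<close> dominates
        both the coefficient 8 and the additive constant \<open>r1 + 2\<close>.\<close>
      have "real r + 1 \<le> c3 * \<Lambda>"
      proof -
        have l0: "0 \<le> ln (1 + t / \<delta>)" using \<delta> by simp
        have "log p (t / \<delta>) \<le> 2 * ln (1 + t / \<delta>)"
        proof (cases "t = 0")
          case False
          have "exp (1/2) \<le> (2::real)"
          proof (rule power_le_imp_le_base[where n = 1])
            show "exp (1/2) ^ Suc 1 \<le> (2::real) ^ Suc 1"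
              using exp_le by (simp add: power2_eq_square flip: exp_add)
          qed simp
          then have "1 / 2 \<le> ln (2::real)" by (subst ln_ge_iff) simp_all
          also have "\<dots> \<le> ln p" using p_ge_2 by simp
          finally have lp: "1 / 2 \<le> ln p" .
          have "log p (t / \<delta>) \<le> ln (1 + t / \<delta>) / ln p"
          proof -
            have "0 < t / \<delta>" using False \<delta> by simp
            then have "ln (t / \<delta>) \<le> ln (1 + t / \<delta>)" by simp
            then show ?thesis unfolding log_def using lp by (intro divide_right_mono) linarith+
          qed
          also have "\<dots> \<le> ln (1 + t / \<delta>) / (1 / 2)" using l0 lp p_ge_2 by (intro divide_left_mono) auto
          finally show ?thesis by simp
        qed (simp add: log_def)
        moreover have "real r \<le> r1 + (4 * log p (t / \<delta>) + 1) \<or> r = r1"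
        proof (cases "r = r1")
          case False
          then have r: "r = nat \<lceil>4 * log p (t / \<delta>)\<rceil>" by (simp add: r_def max_def split: if_splits)
          have "0 < r" using \<open>Suc d \<le> r\<close> by simp
          then have "real r \<le> 4 * log p (t / \<delta>) + 1" unfolding r by linarith
          then show ?thesis by simp
        qed simp
        ultimately have "real r + 1 \<le> r1 + 2 + 8 * ln (1 + t / \<delta>)"
          using l0 by linarith
        also have "\<dots> \<le> c3 * \<Lambda>"
          unfolding c3_def \<Lambda>_def using l0 mult_nonneg_nonneg[of "real r1" "ln (1 + t / \<delta>)"]
          by (simp add: algebra_simps)
        finally show ?thesis .
      qed
      then have "(real r + 1) ^ d \<le> (c3 * \<Lambda>) ^ d" by (intro power_mono) auto
      \<comment> \<open>Only the power \<open>d\<close> of the logarithm arises; it is bounded by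
        the exponent of the claim because \<open>\<Lambda> \<ge> 1\<close>.\<close>
      also have "\<dots> \<le> c3 ^ d * \<Lambda> ^ (3 * d + 3)"
        unfolding power_mult_distrib using \<Lambda>1 by (intro mult_left_mono power_increasing) (auto simp: c3_def)
      finally have "5 * c2 / c1 * (real r + 1) ^ d \<le> 5 * c2 / c1 * (c3 ^ d * \<Lambda> ^ (3 * d + 3))"
        using c1 c2 by (intro mult_left_mono) auto
      also have "\<dots> = C2 * \<Lambda> ^ (3 * d + 3)" by (simp add: C2_def)
      also have "\<dots> \<le> (C1 + C2) * \<Lambda> ^ (3 * d + 3)" using C1 \<Lambda>1 by (intro mult_right_mono) auto
      finally have "5 * c2 / c1 * (real r + 1) ^ d / \<delta> \<le> (C1 + C2) * \<Lambda> ^ (3 * d + 3) / \<delta>"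
        using \<delta> by (intro divide_right_mono) auto
      with q show ?thesis by (meson order_trans)
    qed
    then show "\<exists>T q. real q \<le> (C1 + C2) * (1 + ln (1 + real t / \<delta>)) ^ (3 * d + 3) / \<delta> \<and>
          query_bounded T q \<and>
          (\<forall>f A. is_fn p n f \<and> deg_le p n d f \<and> valid_adversary t A \<longrightarrow> accept_prob T q A f = 1) \<and>
          (\<forall>f A. is_fn p n f \<and> far_from_deg p n d \<delta> f \<and> valid_adversary t A \<longrightarrow> reject_prob T q A f \<ge> 2/3)"
      unfolding valid_tester_def \<Lambda>_def .
  qed
qed

end
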